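(* Let $T>0$ and let $H:\mathbb{R}^n\times\mathbb{R}^n\to\mathbb{R}$ satisfy: $p\mapsto H(x,p)$ is convex for every $x\in\mathbb{R}^n$, and there is a constant $M\geqslant 0$ such that $|H(x,p)-H(x,q)|\leqslant M(1+|x|)|p-q|$ for all $x,p,q\in\mathbb{R}^n$ and $|H(x,p)-H(y,p)|\leqslant M(1+|p|)|x-y|$ for all $x,y,p\in\mathbb{R}^n$. Then an initial function $g_0\in C(\mathbb{R}^n,\mathbb{R})$ is reconstructible in time $T$ if and only if there exists a backward viscosity solution $v$ of $\nabla_t u+H(x,\nabla_x u)=0$ defined on $[0,T]\times\mathbb{R}^n$ such that $g_0(\cdot)=v(0,\cdot)$. Furthermore, if $v$ is such a backward viscosity solution with $v(0,\cdot)=g_0(\cdot)$, $u:[0,T]\times\mathbb{R}^n\to\mathbb{R}$ is a forward viscosity solution satisfying $u(0,\cdot)=g_0(\cdot)$, and $w:[0,T]\times\mathbb{R}^n\to\mathbb{R}$ is a backward viscosity solution satisfying $w(T,\cdot)=u(T,\cdot)$, then $u\geqslant w\geqslant v$.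
   Context: Consider the equation $\nabla_t u+H(x,\nabla_x u)=0$ in $(0,T)\times\mathbb{R}^n$. For a continuous $u$ and $(t,x)\in(0,T)\times\mathbb{R}^n$, $\partial_+u(t,x)$ (resp. $\partial_-u(t,x)$) is the set of $\nabla\varphi(t,x)$ over all $\varphi\in C^1((0,T)\times\mathbb{R}^n)$ such that $u-\varphi$ has a local maximum (resp. local minimum) at $(t,x)$. A continuous $u:[0,T]\times\mathbb{R}^n\to\mathbb{R}$ is a forward viscosity solution if for every $(t,x)\in(0,T)\times\mathbb{R}^n$: $u_t+H(x,u_x)\leqslant0$ for all $(u_t,u_x)\in\partial_+u(t,x)$ and $u_t+H(x,u_x)\geqslant0$ for all $(u_t,u_x)\in\partial_-u(t,x)$. A continuous $w$ is a backward viscosity solution if for every $(t,x)\in(0,T)\times\mathbb{R}^n$: $w_t+H(x,w_x)\geqslant0$ for all $(w_t,w_x)\in\partial_+w(t,x)$ and $w_t+H(x,w_x)\leqslant0$ for all $(w_t,w_x)\in\partial_-w(t,x)$. An initial function $g_0\in C(\mathbb{R}^n,\mathbb{R})$ is reconstructible in time $T$ if $g_0(\cdot)=w(0,\cdot)$, where $w$ is the unique backward viscosity solution on $[0,T]\times\mathbb{R}^n$ with $w(T,\cdot)=u(T,\cdot)$ and $u$ is the unique forward viscosity solution on $[0,T]\times\mathbb{R}^n$ with $u(0,\cdot)=g_0(\cdot)$. *)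

theory Defs
  imports "HOL-Analysis.Analysis"
begin

definition C1_grad :: "(real \<times> 'a::euclidean_space) set \<Rightarrow> (real \<times> 'a \<Rightarrow> real)
    \<Rightarrow> (real \<times> 'a \<Rightarrow> real \<times> 'a) \<Rightarrow> bool" where
  "C1_grad S phi Dphi \<longleftrightarrow>
     (\<forall>z\<in>S. (phi has_derivative (\<lambda>(h, k). fst (Dphi z) * h + snd (Dphi z) \<bullet> k)) (at z))
     \<and> continuous_on S Dphi"

definition superdiff :: "real \<Rightarrow> (real \<Rightarrow> 'a::euclidean_space \<Rightarrow> real) \<Rightarrow> real \<Rightarrow> 'a
    \<Rightarrow> (real \<times> 'a) set" where
  "superdiff T u t x = {Dphi (t, x) | phi Dphi.
     C1_grad ({0<..<T} \<times> UNIV) phi Dphi \<and>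
     (\<exists>e>0. \<forall>s y. s \<in> {0<..<T} \<and> dist (s, y) (t, x) < e \<longrightarrow>
        u s y - phi (s, y) \<le> u t x - phi (t, x))}"

definition subdiff :: "real \<Rightarrow> (real \<Rightarrow> 'a::euclidean_space \<Rightarrow> real) \<Rightarrow> real \<Rightarrow> 'a
    \<Rightarrow> (real \<times> 'a) set" where
  "subdiff T u t x = {Dphi (t, x) | phi Dphi.
     C1_grad ({0<..<T} \<times> UNIV) phi Dphi \<and>
     (\<exists>e>0. \<forall>s y. s \<in> {0<..<T} \<and> dist (s, y) (t, x) < e \<longrightarrow>
        u s y - phi (s, y) \<ge> u t x - phi (t, x))}"

definition forward_visc :: "('a::euclidean_space \<Rightarrow> 'a \<Rightarrow> real) \<Rightarrow> real
    \<Rightarrow> (real \<Rightarrow> 'a \<Rightarrow> real) \<Rightarrow> bool" where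
  "forward_visc H T u \<longleftrightarrow>
     continuous_on ({0..T} \<times> UNIV) (\<lambda>(t, x). u t x) \<and>
     (\<forall>t\<in>{0<..<T}. \<forall>x.
        (\<forall>(a, p)\<in>superdiff T u t x. a + H x p \<le> 0) \<and>
        (\<forall>(a, p)\<in>subdiff T u t x. a + H x p \<ge> 0))"

definition backward_visc :: "('a::euclidean_space \<Rightarrow> 'a \<Rightarrow> real) \<Rightarrow> real
    \<Rightarrow> (real \<Rightarrow> 'a \<Rightarrow> real) \<Rightarrow> bool" where
  "backward_visc H T w \<longleftrightarrow>
     continuous_on ({0..T} \<times> UNIV) (\<lambda>(t, x). w t x) \<and>
     (\<forall>t\<in>{0<..<T}. \<forall>x.
        (\<forall>(a, p)\<in>superdiff T w t x. a + H x p \<ge> 0) \<and>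
        (\<forall>(a, p)\<in>subdiff T w t x. a + H x p \<le> 0))"

text \<open>Equality of two functions on [0,T] x R^n (functions are total in HOL).\<close>
definition agree_on :: "real \<Rightarrow> (real \<Rightarrow> 'a \<Rightarrow> real) \<Rightarrow> (real \<Rightarrow> 'a \<Rightarrow> real) \<Rightarrow> bool" where
  "agree_on T u u' \<longleftrightarrow> (\<forall>t\<in>{0..T}. \<forall>x. u t x = u' t x)"

definition reconstructible :: "('a::euclidean_space \<Rightarrow> 'a \<Rightarrow> real) \<Rightarrow> real
    \<Rightarrow> ('a \<Rightarrow> real) \<Rightarrow> bool" where
  "reconstructible H T g0 \<longleftrightarrow>
     (\<exists>u. forward_visc H T u \<and> u 0 = g0 \<and>
        (\<forall>u'. forward_visc H T u' \<and> u' 0 = g0 \<longrightarrow> agree_on T u' u) \<and>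
        (\<exists>w. backward_visc H T w \<and> w T = u T \<and>
           (\<forall>w'. backward_visc H T w' \<and> w' T = u T \<longrightarrow> agree_on T w' w) \<and>
           w 0 = g0))"

end

theory Submission
  imports Defs "HOL-Complex_Analysis.Great_Picard"
begin

text \<open>
  Write \<open>\<partial>\<^sub>+\<close> and \<open>\<partial>\<^sub>-\<close> for super- and subdifferentials. Time reversal \<open>w \<mapsto> - w (T - t)\<close> exchanges
  backward solutions for \<open>H x p\<close> and forward solutions for \<open>H x (- p)\<close>, a Hamiltonian of the same kind.
  Doubling of variables with a barrier adapted to the speed bound \<open>M (1 + |x|)\<close> gives a comparison principle
  for forward sub- and supersolutions with finite propagation of the initial data, hence without any growth
  restriction.

  For Lipschitz initial data a forward solution is the limit of the semi-discrete control scheme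
  \<open>u (t + h, x) = inf (u (t, x - h v) + h l)\<close>, the infimum being over pairs \<open>(v, l)\<close> with
  \<open>v \<bullet> p - l \<le> H x p\<close> for all \<open>p\<close>. A separation argument shows that this set of pairs depends Lipschitz
  continuously on \<open>x\<close>, so Lipschitz bounds propagate along the scheme, and the dynamic programming inequality
  \<open>u (t + s, x + s v) \<le> u (t, x) + s l + O(s\<^sup>2)\<close> survives in the limit. Read backward in time from a point it
  gives \<open>a + H x p \<le> 0\<close> on \<open>\<partial>\<^sub>+ u\<close>; read forward in time it gives the same inequality on \<open>\<partial>\<^sub>- u\<close>
  (the Barron--Jensen property). Both pass to continuous initial data by stability, and by uniqueness every
  forward solution has the Barron--Jensen property.

  So a forward solution \<open>u\<close> is also a backward supersolution, which gives \<open>w \<le> u\<close>, and a backward solution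
  \<open>v\<close> is also a forward subsolution, which gives \<open>v \<le> u\<close>; then \<open>v \<le> w\<close> follows from
  \<open>v \<le> u = w\<close> at time \<open>T\<close>.
\<close>

section \<open>Viscosity inequalities and time reversal\<close>

text \<open>Treats the pair of time and space derivatives as one gradient in the product space, so
  that test functions can be added, negated and composed without splitting components.\<close>

lemma C1_grad_inner:
  "C1_grad S phi D \<longleftrightarrow>
     (\<forall>z\<in>S. (phi has_derivative (\<lambda>d. D z \<bullet> d)) (at z)) \<and> continuous_on S D"
proof -
  have "(\<lambda>(h, k). fst (D z) * h + snd (D z) \<bullet> k) = (\<lambda>d. D z \<bullet> d)" for z
    by (auto simp: inner_prod_def)
  then show ?thesis
    by (simp add: C1_grad_def)
qed

text \<open>The operator \<open>G\<close> is arbitrary so that one notion covers every inequality in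
  use: subsolutions directly, supersolutions and the Barron-Jensen inequality through
  \<open>- u\<close> and a reflected \<open>G\<close>. Stability is then proved only once.\<close>

definition visc_sub :: "real \<Rightarrow> ('a::euclidean_space \<Rightarrow> real \<times> 'a \<Rightarrow> real)
    \<Rightarrow> (real \<Rightarrow> 'a \<Rightarrow> real) \<Rightarrow> bool" where
  "visc_sub T G u \<longleftrightarrow> (\<forall>t\<in>{0<..<T}. \<forall>x. \<forall>D\<in>superdiff T u t x. G x D \<le> 0)"

lemma superdiffI:
  assumes "C1_grad ({0<..<T} \<times> UNIV) phi Dphi" "e > 0"
    and "\<And>s y. s \<in> {0<..<T} \<Longrightarrow> dist (s, y) (t, x) < e \<Longrightarrow>
           u s y - phi (s, y) \<le> u t x - phi (t, x)"
  shows "Dphi (t, x) \<in> superdiff T u t x"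
  unfolding superdiff_def using assms by blast

lemma superdiffE:
  assumes "D \<in> superdiff T u t x"
  obtains phi Dphi e where "D = Dphi (t, x)" "C1_grad ({0<..<T} \<times> UNIV) phi Dphi" "e > 0"
    "\<And>s y. s \<in> {0<..<T} \<Longrightarrow> dist (s, y) (t, x) < e \<Longrightarrow>
       u s y - phi (s, y) \<le> u t x - phi (t, x)"
  using assms unfolding superdiff_def by blast

lemma C1_grad_uminus: "C1_grad S phi D \<Longrightarrow> C1_grad S (\<lambda>z. - phi z) (\<lambda>z. - D z)"
  by (auto simp: C1_grad_inner intro!: has_derivative_minus continuous_on_minus)

lemma subdiff_iff: "D \<in> subdiff T u t x \<longleftrightarrow> - D \<in> superdiff T (\<lambda>s y. - u s y) t x"
proof
  assume "D \<in> subdiff T u t x"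
  then obtain phi Dphi e where *: "D = Dphi (t, x)" "C1_grad ({0<..<T} \<times> UNIV) phi Dphi" "e > 0"
    "\<And>s y. s \<in> {0<..<T} \<Longrightarrow> dist (s, y) (t, x) < e \<Longrightarrow>
       u s y - phi (s, y) \<ge> u t x - phi (t, x)"
    unfolding subdiff_def by blast
  show "- D \<in> superdiff T (\<lambda>s y. - u s y) t x"
    unfolding *(1) by (rule superdiffI[OF C1_grad_uminus[OF *(2)] *(3)]) (use *(4) in force)
next
  assume "- D \<in> superdiff T (\<lambda>s y. - u s y) t x"
  then obtain phi Dphi e where *: "- D = Dphi (t, x)" "C1_grad ({0<..<T} \<times> UNIV) phi Dphi" "e > 0"
    "\<And>s y. s \<in> {0<..<T} \<Longrightarrow> dist (s, y) (t, x) < e \<Longrightarrow>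
       - u s y - phi (s, y) \<le> - u t x - phi (t, x)"
    by (elim superdiffE) blast
  have "D = - Dphi (t, x)" using *(1) by (metis minus_minus)
  moreover have "\<forall>s y. s \<in> {0<..<T} \<and> dist (s, y) (t, x) < e \<longrightarrow>
       u s y - - phi (s, y) \<ge> u t x - - phi (t, x)" using *(4) by fastforce
  ultimately show "D \<in> subdiff T u t x"
    unfolding subdiff_def using C1_grad_uminus[OF *(2)] *(3) by (intro CollectI exI conjI)
qed

lemma superdiff_cong:
  assumes "t \<in> {0<..<T}" "\<And>s y. s \<in> {0<..<T} \<Longrightarrow> u s y = u' s y"
  shows "superdiff T u t x = superdiff T u' t x"
proof -
  have "superdiff T u t x \<subseteq> superdiff T u' t x"
    if "\<And>s y. s \<in> {0<..<T} \<Longrightarrow> u s y = u' s y" for u u'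
  proof
    fix D assume "D \<in> superdiff T u t x"
    then obtain phi Dphi e where *: "D = Dphi (t, x)" "C1_grad ({0<..<T} \<times> UNIV) phi Dphi" "e > 0"
      "\<And>s y. s \<in> {0<..<T} \<Longrightarrow> dist (s, y) (t, x) < e \<Longrightarrow>
         u s y - phi (s, y) \<le> u t x - phi (t, x)"
      by (elim superdiffE) blast
    show "D \<in> superdiff T u' t x"
      unfolding *(1) by (rule superdiffI[OF *(2,3)]) (use *(4) that assms(1) in auto)
  qed
  from this[of u u'] this[of u' u] show ?thesis using assms(2) by auto
qed

text \<open>The test function is composed with the reflection \<open>R\<close> of time, and the
  chain rule flips the time component only. One implication is enough, because a second reversal
  gives the converse.\<close>

lemma superdiff_time_reverse:
  assumes "t \<in> {0<..<T}" "(a, p) \<in> superdiff T u t x"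
  shows "(- a, p) \<in> superdiff T (\<lambda>s. u (T - s)) (T - t) x"
proof -
  obtain phi Dphi e where *: "(a, p) = Dphi (t, x)" "C1_grad ({0<..<T} \<times> UNIV) phi Dphi" "e > 0"
    "\<And>s y. s \<in> {0<..<T} \<Longrightarrow> dist (s, y) (t, x) < e \<Longrightarrow>
       u s y - phi (s, y) \<le> u t x - phi (t, x)"
    using assms(2) by (elim superdiffE) blast
  define R where "R = (\<lambda>z::real \<times> 'a. (T - fst z, snd z))"
  define psi where "psi = (\<lambda>z. phi (R z))"
  define Dpsi where "Dpsi = (\<lambda>z. (- fst (Dphi (R z)), snd (Dphi (R z))))"
  have "C1_grad ({0<..<T} \<times> UNIV) psi Dpsi"
    unfolding C1_grad_inner
  proof (intro conjI ballI)
    fix z :: "real \<times> 'a" assume z: "z \<in> {0<..<T} \<times> UNIV"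
    have dR: "(R has_derivative (\<lambda>d. (- fst d, snd d))) (at z)"
      unfolding R_def by (auto intro!: derivative_eq_intros)
    have "R z \<in> {0<..<T} \<times> UNIV" using z by (auto simp: R_def)
    then have dp: "(phi has_derivative (\<lambda>d. Dphi (R z) \<bullet> d)) (at (R z))"
      using *(2) by (auto simp: C1_grad_inner)
    show "(psi has_derivative (\<lambda>d. Dpsi z \<bullet> d)) (at z)"
      using has_derivative_compose[OF dR dp] by (simp add: psi_def Dpsi_def inner_prod_def)
  next
    have cR: "continuous_on ({0<..<T} \<times> UNIV) R"
      unfolding R_def by (intro continuous_intros)
    have "R ` ({0<..<T} \<times> UNIV) \<subseteq> {0<..<T} \<times> UNIV" by (auto simp: R_def)
    then have "continuous_on ({0<..<T} \<times> UNIV) (\<lambda>z. Dphi (R z))"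
      using *(2) continuous_on_compose2[OF _ cR] unfolding C1_grad_inner by blast
    then show "continuous_on ({0<..<T} \<times> UNIV) Dpsi"
      unfolding Dpsi_def by (intro continuous_intros)
  qed
  then have "Dpsi (T - t, x) \<in> superdiff T (\<lambda>s. u (T - s)) (T - t) x"
  proof (rule superdiffI[OF _ *(3)])
    fix s y assume s: "s \<in> {0<..<T}" "dist (s, y) (T - t, x) < e"
    have "dist (T - s, y) (t, x) = dist (s, y) (T - t, x)"
      by (simp add: dist_Pair_Pair dist_real_def abs_minus_commute algebra_simps)
    then show "u (T - s) y - psi (s, y) \<le> u (T - (T - t)) x - psi (T - t, x)"
      using *(4)[of "T - s" y] s by (simp add: psi_def R_def)
  qed
  moreover have "Dpsi (T - t, x) = (- a, p)"
    using *(1)[symmetric] by (simp add: Dpsi_def R_def)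
  ultimately show ?thesis by simp
qed

section \<open>Time reversal combined with negation\<close>

definition time_rev :: "real \<Rightarrow> (real \<Rightarrow> 'a \<Rightarrow> real) \<Rightarrow> real \<Rightarrow> 'a \<Rightarrow> real" where
  "time_rev T w t x = - w (T - t) x"

lemma time_rev_time_rev [simp]: "time_rev T (time_rev T w) = w"
  by (auto simp: time_rev_def fun_eq_iff)

lemma continuous_on_time_rev:
  assumes "continuous_on ({0..T} \<times> UNIV) (\<lambda>(t, x). w t x)"
  shows "continuous_on ({0..T} \<times> UNIV) (\<lambda>(t, x). time_rev T w t x)"
proof -
  have "continuous_on ({0..T} \<times> UNIV) (\<lambda>z. (T - fst z, snd z))"
    by (intro continuous_intros)
  moreover have "(\<lambda>z. (T - fst z, snd z)) ` ({0..T} \<times> UNIV) \<subseteq> {0..T} \<times> UNIV"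
    by auto
  ultimately have "continuous_on ({0..T} \<times> UNIV) (\<lambda>z. (\<lambda>(t, x). w t x) (T - fst z, snd z))"
    using assms continuous_on_compose2 by blast
  then show ?thesis
    by (auto simp: time_rev_def case_prod_unfold intro: continuous_on_minus)
qed

text \<open>Negation and reversal each change the sign of the time derivative, and the two changes
  cancel. Only the momentum is reflected, which preserves convexity of the Hamiltonian in
  \<open>p\<close>.\<close>

lemma superdiff_time_rev_iff:
  assumes "t \<in> {0<..<T}"
  shows "(a, p) \<in> superdiff T (time_rev T w) t x \<longleftrightarrow> (a, - p) \<in> subdiff T w (T - t) x"
proof -
  have 1: "(\<lambda>s. time_rev T w (T - s)) = (\<lambda>s y. - w s y)"
    "(\<lambda>s y. - w (T - s) y) = time_rev T w"
    by (auto simp: time_rev_def fun_eq_iff)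
  show ?thesis
    using superdiff_time_reverse[of t T a p "time_rev T w" x]
      superdiff_time_reverse[of "T - t" T "- a" p "\<lambda>s y. - w s y" x] assms
    by (auto simp: subdiff_iff 1)
qed

lemma visc_sub_time_rev:
  "visc_sub T G (time_rev T w) \<longleftrightarrow>
     (\<forall>t\<in>{0<..<T}. \<forall>x. \<forall>(a, p)\<in>subdiff T w t x. G x (a, - p) \<le> 0)"
proof
  assume *: "visc_sub T G (time_rev T w)"
  show "\<forall>t\<in>{0<..<T}. \<forall>x. \<forall>(a, p)\<in>subdiff T w t x. G x (a, - p) \<le> 0"
  proof (clarify)
    fix t x a p assume "t \<in> {0<..<T}" "(a, p) \<in> subdiff T w t x"
    then have "T - t \<in> {0<..<T}" "(a, - p) \<in> superdiff T (time_rev T w) (T - t) x"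
      using superdiff_time_rev_iff[of "T - t" T a "- p" w x] by auto
    then show "G x (a, - p) \<le> 0"
      using * unfolding visc_sub_def by blast
  qed
next
  assume *: "\<forall>t\<in>{0<..<T}. \<forall>x. \<forall>(a, p)\<in>subdiff T w t x. G x (a, - p) \<le> 0"
  show "visc_sub T G (time_rev T w)"
    unfolding visc_sub_def
  proof (intro ballI allI)
    fix t x D assume D: "t \<in> {0<..<T}" "D \<in> superdiff T (time_rev T w) t x"
    obtain a p where "D = (a, p)" by force
    then have "T - t \<in> {0<..<T}" "(a, - p) \<in> subdiff T w (T - t) x"
      using superdiff_time_rev_iff[of t T a p w x] D by auto
    then have "G x (a, - (- p)) \<le> 0"
      using * by blast
    then show "G x D \<le> 0"
      using \<open>D = (a, p)\<close> by simp
  qed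
qed

lemma visc_sub_uminus:
  "visc_sub T G (\<lambda>t x. - w t x) \<longleftrightarrow>
     (\<forall>t\<in>{0<..<T}. \<forall>x. \<forall>D\<in>subdiff T w t x. G x (- D) \<le> 0)"
proof -
  have "(\<forall>D\<in>S. G x D \<le> 0) \<longleftrightarrow> (\<forall>D. - D \<in> S \<longrightarrow> G x (- D) \<le> 0)" for x S
    by (metis minus_minus)
  then show ?thesis
    unfolding visc_sub_def subdiff_iff Ball_def by simp
qed

lemma forward_visc_iff:
  "forward_visc H T u \<longleftrightarrow> continuous_on ({0..T} \<times> UNIV) (\<lambda>(t, x). u t x) \<and>
     visc_sub T (\<lambda>x D. fst D + H x (snd D)) u \<and>
     visc_sub T (\<lambda>x D. fst D - H x (- snd D)) (\<lambda>t x. - u t x)"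
proof -
  have "fst (- D) - H x (- snd (- D)) \<le> 0 \<longleftrightarrow> fst D + H x (snd D) \<ge> 0" for x and D :: "real \<times> 'a"
    by auto
  then show ?thesis
    by (simp add: forward_visc_def visc_sub_uminus visc_sub_def split_def ball_conj_distrib all_conj_distrib)
qed

lemma visc_sub_uminus_time_rev:
  "visc_sub T G (\<lambda>t x. - time_rev T w t x) \<longleftrightarrow>
     (\<forall>t\<in>{0<..<T}. \<forall>x. \<forall>(a, p)\<in>superdiff T w t x. G x (- a, p) \<le> 0)"
proof -
  have *: "(\<lambda>t x. - time_rev T w t x) = time_rev T (\<lambda>t x. - w t x)"
    by (simp add: time_rev_def fun_eq_iff)
  have "(\<forall>(a, p)\<in>subdiff T (\<lambda>t x. - w t x) t x. G x (a, - p) \<le> 0) \<longleftrightarrow>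
    (\<forall>(a, p)\<in>superdiff T w t x. G x (- a, p) \<le> 0)" for t x
  proof
    assume 1: "\<forall>(a, p)\<in>subdiff T (\<lambda>t x. - w t x) t x. G x (a, - p) \<le> 0"
    show "\<forall>(a, p)\<in>superdiff T w t x. G x (- a, p) \<le> 0"
    proof clarify
      fix a p assume "(a, p) \<in> superdiff T w t x"
      then have "(- a, - p) \<in> subdiff T (\<lambda>t x. - w t x) t x"
        by (simp add: subdiff_iff)
      then have "G x (- a, - (- p)) \<le> 0"
        using 1 by blast
      then show "G x (- a, p) \<le> 0" by simp
    qed
  next
    assume 1: "\<forall>(a, p)\<in>superdiff T w t x. G x (- a, p) \<le> 0"
    show "\<forall>(a, p)\<in>subdiff T (\<lambda>t x. - w t x) t x. G x (a, - p) \<le> 0"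
    proof clarify
      fix a p assume "(a, p) \<in> subdiff T (\<lambda>t x. - w t x) t x"
      then have "(- a, - p) \<in> superdiff T w t x"
        by (simp add: subdiff_iff)
      then have "G x (- (- a), - p) \<le> 0"
        using 1 by blast
      then show "G x (a, - p) \<le> 0" by simp
    qed
  qed
  then show ?thesis
    unfolding * visc_sub_time_rev by simp
qed

lemma backward_visc_iff:
  "backward_visc H T w \<longleftrightarrow> forward_visc (\<lambda>x p. H x (- p)) T (time_rev T w)"
proof -
  have "continuous_on ({0..T} \<times> UNIV) (\<lambda>(t, x). w t x) \<longleftrightarrow>
    continuous_on ({0..T} \<times> UNIV) (\<lambda>(t, x). time_rev T w t x)"
    using continuous_on_time_rev[of T w] continuous_on_time_rev[of T "time_rev T w"] by auto
  moreover have *: "- a - b \<le> 0 \<longleftrightarrow> a + b \<ge> 0" for a b :: real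
    by auto
  ultimately show ?thesis
    by (auto simp: forward_visc_iff visc_sub_time_rev visc_sub_uminus_time_rev backward_visc_def split_def *
          ball_conj_distrib all_conj_distrib)
qed

section \<open>Local comparison principle\<close>

text \<open>Squaring smooths the kink of the positive part, so a barrier built from it may be used
  in a C^1 test function although it vanishes identically on a region.\<close>

lemma has_real_derivative_max_0_power2:
  "((\<lambda>s::real. (max 0 s)\<^sup>2) has_real_derivative 2 * max 0 s) (at s)"
proof -
  consider "s < 0" | "s > 0" | "s = 0" by linarith
  then show ?thesis
  proof cases
    case 1
    have "((\<lambda>s::real. 0) has_real_derivative 2 * max 0 s) (at s)" using 1 by simp
    then show ?thesis
      by (rule has_field_derivative_transform_within_open[of _ _ _ "{..<0}"]) (use 1 in auto)
  next
    case 2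
    have "((\<lambda>s::real. s\<^sup>2) has_real_derivative 2 * max 0 s) (at s)"
      using 2 by (auto intro!: derivative_eq_intros)
    then show ?thesis
      by (rule has_field_derivative_transform_within_open[of _ _ _ "{0<..}"]) (use 2 in auto)
  next
    case 3
    have "(\<lambda>h. ((max 0 h)\<^sup>2 - (max 0 0)\<^sup>2) / (h - 0)) \<midarrow>(0::real)\<rightarrow> 0"
    proof (rule Lim_null_comparison)
      show "\<forall>\<^sub>F h in at (0::real). norm (((max 0 h)\<^sup>2 - (max 0 0)\<^sup>2) / (h - 0)) \<le> \<bar>h\<bar>"
        by (intro always_eventually allI) (auto simp: max_def power2_eq_square)
      show "(\<lambda>h. \<bar>h\<bar>) \<midarrow>(0::real)\<rightarrow> 0"
        by (rule tendsto_rabs_zero) simp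
    qed
    then show ?thesis
      unfolding has_field_derivative_iff using 3 by simp
  qed
qed

lemma C1_grad_add:
  "C1_grad S f Df \<Longrightarrow> C1_grad S g Dg \<Longrightarrow> C1_grad S (\<lambda>z. f z + g z) (\<lambda>z. Df z + Dg z)"
  by (auto simp: C1_grad_inner inner_add_left intro!: has_derivative_add continuous_on_add)

lemma C1_grad_square_dist:
  fixes z0 :: "real \<times> 'a::euclidean_space"
  shows "C1_grad S (\<lambda>z. N * (norm (z - z0))\<^sup>2) (\<lambda>z. (2 * N) *\<^sub>R (z - z0))"
  unfolding C1_grad_inner power2_norm_eq_inner
  by (auto intro!: derivative_eq_intros continuous_intros simp: inner_commute algebra_simps)

text \<open>The first term penalises leaving the region
  \<open>exp (K * t) * (1 + |x|^2) \<le> R\<close>, the second penalises times after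
  \<open>t0\<close>. Where both constraints hold, the barrier and its gradient are zero.\<close>

lemma C1_grad_barrier:
  fixes R C K t0 :: real
  shows "C1_grad S (\<lambda>z::real \<times> 'a::euclidean_space.
       C * (max 0 (exp (K * fst z) * (1 + snd z \<bullet> snd z) - R))\<^sup>2 + C * (max 0 (fst z - t0))\<^sup>2)
     (\<lambda>z. (C * (2 * max 0 (exp (K * fst z) * (1 + snd z \<bullet> snd z) - R))
              * (K * exp (K * fst z) * (1 + snd z \<bullet> snd z)) + C * (2 * max 0 (fst z - t0)),
           (C * (2 * max 0 (exp (K * fst z) * (1 + snd z \<bullet> snd z) - R)) * (2 * exp (K * fst z))) *\<^sub>R snd z))"
  unfolding C1_grad_inner
proof (intro conjI ballI)
  fix z :: "real \<times> 'a"
  have *: "((\<lambda>s::real. (max 0 s)\<^sup>2) has_derivative (\<lambda>h. 2 * max 0 s * h)) (at s)" for s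
    using has_real_derivative_max_0_power2[of s] unfolding has_field_derivative_def by simp
  have 1: "((\<lambda>z::real \<times> 'a. exp (K * fst z) * (1 + snd z \<bullet> snd z) - R) has_derivative
     (\<lambda>d. K * exp (K * fst z) * (1 + snd z \<bullet> snd z) * fst d + 2 * exp (K * fst z) * (snd z \<bullet> snd d))) (at z)"
    by (auto intro!: derivative_eq_intros simp: inner_commute algebra_simps)
  have 2: "((\<lambda>z::real \<times> 'a. fst z - t0) has_derivative fst) (at z)"
    by (auto intro!: derivative_eq_intros)
  show "((\<lambda>z. C * (max 0 (exp (K * fst z) * (1 + snd z \<bullet> snd z) - R))\<^sup>2 + C * (max 0 (fst z - t0))\<^sup>2)
     has_derivative
     (\<lambda>d. (C * (2 * max 0 (exp (K * fst z) * (1 + snd z \<bullet> snd z) - R))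
              * (K * exp (K * fst z) * (1 + snd z \<bullet> snd z)) + C * (2 * max 0 (fst z - t0)),
           (C * (2 * max 0 (exp (K * fst z) * (1 + snd z \<bullet> snd z) - R)) * (2 * exp (K * fst z))) *\<^sub>R snd z) \<bullet> d)) (at z)"
    by (rule has_derivative_eq_rhs[OF has_derivative_add[OF
          has_derivative_mult_right[OF has_derivative_compose[OF 1 *]]
          has_derivative_mult_right[OF has_derivative_compose[OF 2 *]]]])
      (auto simp: inner_prod_def fun_eq_iff algebra_simps)
next
  show "continuous_on S (\<lambda>z::real \<times> 'a. (C * (2 * max 0 (exp (K * fst z) * (1 + snd z \<bullet> snd z) - R))
              * (K * exp (K * fst z) * (1 + snd z \<bullet> snd z)) + C * (2 * max 0 (fst z - t0)),
           (C * (2 * max 0 (exp (K * fst z) * (1 + snd z \<bullet> snd z) - R)) * (2 * exp (K * fst z))) *\<^sub>R snd z))"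
    by (intro continuous_intros)
qed

text \<open>The barrier satisfies \<open>\<zeta>\<^sub>t \<ge> M (1 + |x|) |\<zeta>\<^sub>x|\<close>, so subtracting it keeps a subsolution a subsolution,
  while it is as large as desired away from the backward cone of \<open>(t0, x0)\<close>: speeds are at most
  \<open>M (1 + |x|)\<close>, so \<open>exp (3 M t) (1 + |x|\<^sup>2)\<close> controls the propagation.\<close>

lemma comparison_local:
  fixes H :: "'a::euclidean_space \<Rightarrow> 'a \<Rightarrow> real" and u v :: "real \<Rightarrow> 'a \<Rightarrow> real"
  assumes M: "M \<ge> 0"
    and lip_p: "\<And>x p q. \<bar>H x p - H x q\<bar> \<le> M * (1 + norm x) * norm (p - q)"
    and lip_x: "\<And>x y p. \<bar>H x p - H y p\<bar> \<le> M * (1 + norm p) * norm (x - y)"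
    and cu: "continuous_on ({0..T} \<times> UNIV) (\<lambda>(t, x). u t x)"
    and cv: "continuous_on ({0..T} \<times> UNIV) (\<lambda>(t, x). v t x)"
    and sub: "visc_sub T (\<lambda>x D. fst D + H x (snd D)) u"
    and super: "visc_sub T (\<lambda>x D. fst D - H x (- snd D)) (\<lambda>t x. - v t x)"
    and t0: "t0 \<in> {0..<T}"
    and init: "\<And>x. norm x \<le> exp (3 * M * T) * (1 + (norm x0)\<^sup>2) + 2 \<Longrightarrow> u 0 x \<le> v 0 x + c"
  shows "u t0 x0 \<le> v t0 x0 + c"
proof (rule ccontr)
  assume contra: "\<not> ?thesis"
  define \<sigma> where "\<sigma> = u t0 x0 - v t0 x0 - c"
  have \<sigma>: "\<sigma> > 0" using contra by (simp add: \<sigma>_def)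
  have T: "T > 0" using t0 by auto
  \<comment> \<open>With this \<open>R\<close> the barrier vanishes at \<open>(t0, x0)\<close>, and
    the initial ordering is available on the whole ball of radius \<open>R + 2\<close> that bounds
    \<open>K\<close>.\<close>
  define R where "R = exp (3 * M * T) * (1 + (norm x0)\<^sup>2)"
  have eT: "exp (3 * M * t) \<ge> 1" if "t \<ge> 0" for t using M that by simp
  have eR: "exp (3 * M * t) * (1 + (norm x0)\<^sup>2) \<le> R" if "t \<le> T" for t
    unfolding R_def using that M by (intro mult_right_mono) (auto intro: mult_left_mono)
  have R0: "1 + (norm x0)\<^sup>2 \<le> R" using eR[of 0] T by simp
  have R1: "R \<ge> 1" using R0 by (smt (verit) zero_le_power2)
  have nx0: "norm x0 \<le> R"
  proof -
    have "0 \<le> (norm x0 - 1)\<^sup>2" by simp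
    also have "\<dots> = (norm x0)\<^sup>2 + 1 - 2 * norm x0" by (simp add: power2_diff)
    finally show ?thesis using R0 by (smt (verit) norm_ge_zero)
  qed
  define K where "K = {0..T} \<times> cball (0::'a) (R + 2)"
  have K: "compact K" unfolding K_def by (intro compact_Times compact_Icc compact_cball)
  have KT: "K \<subseteq> {0..T} \<times> UNIV" by (auto simp: K_def)
  define U where "U = (\<lambda>z. u (fst z) (snd z))"
  define V where "V = (\<lambda>z. v (fst z) (snd z))"
  have cU: "continuous_on K U" and cV: "continuous_on K V"
    using cu cv KT continuous_on_subset unfolding U_def V_def case_prod_unfold by blast+
  obtain B1 B2 where B1: "\<And>z. z \<in> K \<Longrightarrow> \<bar>U z\<bar> \<le> B1" and B2: "\<And>z. z \<in> K \<Longrightarrow> \<bar>V z\<bar> \<le> B2"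
    using compact_imp_bounded[OF compact_continuous_image[OF cU K]]
      compact_imp_bounded[OF compact_continuous_image[OF cV K]]
    unfolding bounded_iff by auto
  define B where "B = \<bar>B1\<bar> + \<bar>B2\<bar>"
  have B: "B \<ge> 0" "\<And>z. z \<in> K \<Longrightarrow> \<bar>U z\<bar> \<le> B" "\<And>z. z \<in> K \<Longrightarrow> \<bar>V z\<bar> \<le> B"
    using B1 B2 unfolding B_def by force+
  \<comment> \<open>The term \<open>\<eta> * t\<close> makes the subsolution inequality strict, and
    this choice costs at most half of the excess \<open>\<sigma>\<close> at
    \<open>t0\<close>.\<close>
  define \<eta> where "\<eta> = \<sigma> / (2 * T)"
  have \<eta>: "\<eta> > 0" and \<eta>t0: "\<eta> * t0 \<le> \<sigma> / 2"
    using \<sigma> T t0 by (auto simp: \<eta>_def field_simps)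
  \<comment> \<open>Moving \<open>H\<close> between \<open>x\<close> and \<open>y\<close> will cost
    at most \<open>M * (3 * \<rho>)\<close>, which has to stay below \<open>\<eta>\<close>. The
    bound \<open>\<sigma> / 4\<close> excludes a maximum at time 0.\<close>
  define \<rho> where "\<rho> = min (\<sigma> / 4) (\<eta> / (4 * (M + 1)))"
  have "\<rho> > 0" using \<sigma> \<eta> M by (simp add: \<rho>_def)
  moreover have "\<rho> \<le> \<sigma> / 4" unfolding \<rho>_def by (rule min.cobounded1)
  ultimately have \<rho>: "\<rho> > 0" "\<rho> \<le> \<sigma> / 4" by blast+
  have "M * (3 * \<rho>) \<le> M * (3 * (\<eta> / (4 * (M + 1))))"
    using M by (intro mult_left_mono) (auto simp: \<rho>_def)
  also have "\<dots> < \<eta>" using M \<eta> by (simp add: field_simps) (smt (verit) mult_nonneg_nonneg)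
  finally have M\<rho>: "M * (3 * \<rho>) < \<eta>" .
  obtain d1 where d1: "d1 > 0" "\<And>z z'. z \<in> K \<Longrightarrow> z' \<in> K \<Longrightarrow> dist z' z < d1 \<Longrightarrow> \<bar>U z' - U z\<bar> < \<rho>"
    using compact_uniformly_continuous[OF cU K] \<rho>(1) unfolding uniformly_continuous_on_def dist_real_def
    by metis
  obtain d2 where d2: "d2 > 0" "\<And>z z'. z \<in> K \<Longrightarrow> z' \<in> K \<Longrightarrow> dist z' z < d2 \<Longrightarrow> \<bar>V z' - V z\<bar> < \<rho>"
    using compact_uniformly_continuous[OF cV K] \<rho>(1) unfolding uniformly_continuous_on_def dist_real_def
    by metis
  define \<delta> where "\<delta> = min (min d1 d2) (min \<rho> (min 1 ((T - t0) / 2)))"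
  have \<delta>: "\<delta> > 0" "\<delta> \<le> d1" "\<delta> \<le> d2" "\<delta> \<le> \<rho>" "\<delta> \<le> 1" "\<delta> \<le> (T - t0) / 2"
    using d1(1) d2(1) \<rho>(1) t0 unfolding \<delta>_def by (auto simp: min_def)
  \<comment> \<open>A pair at distance \<open>\<delta>\<close> or more pays at least
    \<open>2 * B + 1\<close>, which exceeds the oscillation of \<open>V\<close> on
    \<open>K\<close>.\<close>
  define N where "N = (2 * B + 1) / \<delta>\<^sup>2"
  have N: "N > 0" "N * \<delta>\<^sup>2 = 2 * B + 1" using \<delta>(1) B(1) by (auto simp: N_def)
  \<comment> \<open>After time \<open>(t0 + T) / 2\<close> one positive part in
    \<open>\<zeta>\<close> is at least \<open>(T - t0) / 2\<close>; for
    \<open>|x| \<ge> R + 1\<close> the other is at least 1. In both cases this \<open>C\<close>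
    makes \<open>\<zeta>\<close> larger than a maximum of the doubled function allows.\<close>
  define C where "C = (2 * B + \<bar>c\<bar> + \<sigma> + 1) / min 1 (((T - t0) / 2)\<^sup>2)"
  have m0: "min 1 (((T - t0) / 2)\<^sup>2) > 0" using t0 by auto
  have C0: "C > 0" unfolding C_def using m0 B(1) \<sigma> by (intro divide_pos_pos) auto
  have Cm: "C * min 1 (((T - t0) / 2)\<^sup>2) = 2 * B + \<bar>c\<bar> + \<sigma> + 1"
    unfolding C_def by (rule nonzero_eq_divide_eq[THEN iffD1, OF _ refl]) (use m0 in linarith)
  have Cbig: "C * r \<ge> 2 * B + \<bar>c\<bar> + \<sigma> + 1" if "r \<ge> min 1 (((T - t0) / 2)\<^sup>2)" for r
    using mult_left_mono[OF that, of C] C0 Cm by simp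
  define e where "e = (\<lambda>z::real \<times> 'a. exp (3 * M * fst z))"
  define m where "m = (\<lambda>z::real \<times> 'a. max 0 (e z * (1 + snd z \<bullet> snd z) - R))"
  define \<zeta> where "\<zeta> = (\<lambda>z. C * (m z)\<^sup>2 + C * (max 0 (fst z - t0))\<^sup>2)"
  define D\<zeta> where "D\<zeta> = (\<lambda>z. (C * (2 * m z) * (3 * M * e z * (1 + snd z \<bullet> snd z)) + C * (2 * max 0 (fst z - t0)),
           (C * (2 * m z) * (2 * e z)) *\<^sub>R snd z))"
  have \<zeta>C1: "C1_grad S \<zeta> D\<zeta>" for S
    unfolding \<zeta>_def D\<zeta>_def m_def e_def by (rule C1_grad_barrier)
  have \<zeta>0: "\<zeta> z \<ge> 0" for z unfolding \<zeta>_def using C0 by simp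
  have \<zeta>cont: "continuous_on S \<zeta>" for S unfolding \<zeta>_def m_def e_def by (intro continuous_intros)
  define z0 where "z0 = (t0, x0)"
  have z0K: "z0 \<in> K" unfolding z0_def K_def using t0 nx0 by auto
  have \<zeta>z0: "\<zeta> z0 = 0"
    using eR[of t0] t0 by (simp add: \<zeta>_def m_def e_def z0_def power2_norm_eq_inner max_def)
  define \<Phi> where "\<Phi> = (\<lambda>w. U (fst w) - V (snd w) - N * (norm (fst w - snd w))\<^sup>2 - \<zeta> (fst w) - \<eta> * fst (fst w))"
  have "continuous_on (K \<times> K) \<Phi>"
  proof -
    have "continuous_on (K \<times> K) (\<lambda>w. U (fst w))" "continuous_on (K \<times> K) (\<lambda>w. V (snd w))"
      "continuous_on (K \<times> K) (\<lambda>w. \<zeta> (fst w))"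
      by (rule continuous_on_compose2[OF cU] continuous_on_compose2[OF cV]
          continuous_on_compose2[OF \<zeta>cont[of UNIV]]; auto intro: continuous_intros)+
    then show ?thesis unfolding \<Phi>_def by (intro continuous_intros)
  qed
  then obtain w where w: "w \<in> K \<times> K" and wmax: "\<And>w'. w' \<in> K \<times> K \<Longrightarrow> \<Phi> w' \<le> \<Phi> w"
    using continuous_attains_sup[of "K \<times> K" \<Phi>] compact_Times[OF K K] z0K by blast
  obtain z z' where zz': "w = (z, z')" by (rule prod.exhaust)
  have zK: "z \<in> K" "z' \<in> K" using w zz' by auto
  have \<Phi>w: "\<Phi> w = U z - V z' - N * (norm (z - z'))\<^sup>2 - \<zeta> z - \<eta> * fst z" by (simp add: \<Phi>_def zz')
  have "\<Phi> (z0, z0) = c + \<sigma> - \<eta> * t0" by (simp add: \<Phi>_def \<zeta>z0) (simp add: U_def V_def z0_def \<sigma>_def)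
  then have \<Phi>big: "\<Phi> w \<ge> c + \<sigma> / 2" using wmax[of "(z0, z0)"] z0K \<eta>t0 by simp
  \<comment> \<open>Comparison with the diagonal pair \<open>(z, z)\<close>: the barrier and
    \<open>\<eta> * t\<close> depend on the first point only and cancel, so the penalty is
    controlled by the variation of \<open>V\<close> alone.\<close>
  have pen: "N * (norm (z - z'))\<^sup>2 \<le> V z - V z'"
    using wmax[of "(z, z)"] zK(1) by (simp add: \<Phi>w) (simp add: \<Phi>_def)
  have close: "norm (z - z') < \<delta>"
  proof (rule ccontr)
    assume "\<not> norm (z - z') < \<delta>"
    then have "N * \<delta>\<^sup>2 \<le> N * (norm (z - z'))\<^sup>2"
      using N(1) \<delta>(1) by (intro mult_left_mono power_mono) auto
    then show False using pen B(3)[OF zK(1)] B(3)[OF zK(2)] N(2) by linarith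
  qed
  have UV: "\<bar>U z - U z'\<bar> < \<rho>" "\<bar>V z - V z'\<bar> < \<rho>"
    using d1(2)[of z' z] d2(2)[of z' z] zK close \<delta>(2,3) by (auto simp: dist_norm)
  have pen\<rho>: "N * (norm (z - z'))\<^sup>2 < \<rho>" using pen UV(2) by linarith
  obtain t x where z: "z = (t, x)" by (rule prod.exhaust)
  obtain s y where z': "z' = (s, y)" by (rule prod.exhaust)
  have dts: "\<bar>t - s\<bar> < \<delta>" and dxy: "norm (x - y) < \<delta>"
    using close norm_fst_le[where x = "t - s" and y = "x - y"] norm_snd_le[where x = "t - s" and y = "x - y"] by (auto simp: z z')
  have tx: "0 \<le> t" "t \<le> T" "0 \<le> s" "s \<le> T" "norm x \<le> R + 2" "norm y \<le> R + 2"
    using zK by (auto simp: K_def z z')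
  have \<eta>t: "\<eta> * t \<ge> 0" using \<eta> tx by simp
  have Nn: "N * (norm (z - z'))\<^sup>2 \<ge> 0" using N(1) by simp
  have \<Phi>le: "c + \<sigma> / 2 \<le> U z - V z' - \<zeta> z" using \<Phi>big \<Phi>w Nn \<eta>t by (simp add: z)
  have t_pos: "t \<noteq> 0"
  proof
    assume "t = 0"
    then have "U z \<le> V z + c" using init[of x] tx by (simp add: U_def V_def z R_def)
    then show False using \<Phi>le UV(2) \<zeta>0[of z] \<rho> \<sigma> by linarith
  qed
  have s_pos: "s \<noteq> 0"
  proof
    assume "s = 0"
    then have "U z' \<le> V z' + c" using init[of y] tx by (simp add: U_def V_def z' R_def)
    then show False using \<Phi>le UV(1) \<zeta>0[of z] \<rho> \<sigma> by linarith
  qed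
  have \<zeta>small: "\<zeta> z < 2 * B + \<bar>c\<bar> + \<sigma> + 1"
    using \<Phi>le B(2)[OF zK(1)] B(3)[OF zK(2)] \<sigma> by linarith
  have t_lt: "t < (t0 + T) / 2"
  proof (rule ccontr)
    assume "\<not> t < (t0 + T) / 2"
    then have "(T - t0) / 2 \<le> max 0 (t - t0)" by (simp add: field_simps max_def)
    then have "((T - t0) / 2)\<^sup>2 \<le> (max 0 (t - t0))\<^sup>2" using t0 by (intro power_mono) auto
    then have "C * (max 0 (t - t0))\<^sup>2 \<ge> 2 * B + \<bar>c\<bar> + \<sigma> + 1" by (intro Cbig) auto
    moreover have "C * (m z)\<^sup>2 \<ge> 0" using C0 by simp
    ultimately show False using \<zeta>small by (simp add: \<zeta>_def z)
  qed
  have x_lt: "norm x < R + 1"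
  proof (rule ccontr)
    assume "\<not> norm x < R + 1"
    then have "norm x \<ge> R + 1" by simp
    then have "(norm x)\<^sup>2 \<ge> (R + 1)\<^sup>2" using R1 by (intro power_mono) auto
    moreover have "(R + 1)\<^sup>2 \<ge> R + 1" using R1 by (simp add: power2_eq_square)
    ultimately have "1 + x \<bullet> x \<ge> R + 1" by (simp add: power2_norm_eq_inner)
    moreover have "e z \<ge> 1" using eT tx by (simp add: e_def z)
    ultimately have "e z * (1 + x \<bullet> x) \<ge> 1 * (R + 1)" using R1 by (intro mult_mono) auto
    then have "m z \<ge> 1" by (simp add: m_def z)
    then have "(m z)\<^sup>2 \<ge> 1" by simp
    then have "C * (m z)\<^sup>2 \<ge> 2 * B + \<bar>c\<bar> + \<sigma> + 1" by (intro Cbig) auto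
    moreover have "C * (max 0 (t - t0))\<^sup>2 \<ge> 0" using C0 by simp
    ultimately show False using \<zeta>small by (simp add: \<zeta>_def z)
  qed
  have tQ: "t \<in> {0<..<T}" using tx t_pos t_lt t0 by auto
  have sQ: "s \<in> {0<..<T}" using tx s_pos t_lt t0 dts \<delta>(6) by (auto simp: field_simps)
  have y_lt: "norm y < R + 2"
    using x_lt dxy \<delta>(5) norm_triangle_ineq2[of y x] by (simp add: norm_minus_commute)
  \<comment> \<open>Points this close to the maximiser stay in \<open>K\<close>, so the maximum over
    \<open>K\<close> is a local maximum in each variable separately and yields
    superdifferentials.\<close>
  have inK: "(r, k) \<in> K" if "r \<in> {0<..<T}" "dist (r, k) (r0, k0) < R + 2 - norm k0" for r k r0 k0
  proof -
    have "dist k k0 < R + 2 - norm k0"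
      using that(2) dist_snd_le[of "(r, k)" "(r0, k0)"] by simp
    then have "norm k < R + 2" using norm_triangle_ineq2[of k k0] by (simp add: dist_norm)
    then show ?thesis using that(1) by (auto simp: K_def)
  qed
  define q where "q = (2 * N) *\<^sub>R (x - y)"
  define a where "a = 2 * N * (t - s)"
  \<comment> \<open>The common factor of the two cone terms of \<open>D\<zeta>\<close>: the spatial
    gradient is \<open>2 g x\<close>, and the matching part of the time derivative is
    \<open>3 M g (1 + |x|^2)\<close>.\<close>
  define g where "g = C * (2 * m z) * e z"
  have g0: "g \<ge> 0" unfolding g_def using C0 by (simp add: m_def e_def)
  have "C1_grad ({0<..<T} \<times> UNIV) (\<lambda>w::real \<times> 'a. \<eta> * fst w) (\<lambda>w. (\<eta>, 0))"
    by (auto simp: C1_grad_inner inner_prod_def intro!: derivative_eq_intros continuous_intros)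
  then have C1a: "C1_grad ({0<..<T} \<times> UNIV)
    (\<lambda>w. N * (norm (w - z'))\<^sup>2 + \<zeta> w + \<eta> * fst w) (\<lambda>w. (2 * N) *\<^sub>R (w - z') + D\<zeta> w + (\<eta>, 0))"
    by (intro C1_grad_add C1_grad_square_dist \<zeta>C1)
  have "(\<lambda>w. (2 * N) *\<^sub>R (w - z') + D\<zeta> w + (\<eta>, 0)) (t, x) \<in> superdiff T u t x"
  proof (rule superdiffI[OF C1a, of "R + 2 - norm x"])
    show "R + 2 - norm x > 0" using x_lt by simp
    fix r k assume "r \<in> {0<..<T}" "dist (r, k) (t, x) < R + 2 - norm x"
    then have "(r, k) \<in> K" by (rule inK)
    then have "\<Phi> ((r, k), z') \<le> \<Phi> w" using wmax zK by simp
    then show "u r k - (N * (norm ((r, k) - z'))\<^sup>2 + \<zeta> (r, k) + \<eta> * fst (r, k))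
      \<le> u t x - (N * (norm ((t, x) - z'))\<^sup>2 + \<zeta> (t, x) + \<eta> * fst (t, x))"
      unfolding \<Phi>w by (simp add: \<Phi>_def U_def z)
  qed
  moreover have "(\<lambda>w. (2 * N) *\<^sub>R (w - z') + D\<zeta> w + (\<eta>, 0)) (t, x)
    = (a + g * (3 * M * (1 + x \<bullet> x)) + C * (2 * max 0 (t - t0)) + \<eta>, q + (2 * g) *\<^sub>R x)"
    by (simp add: z' D\<zeta>_def a_def q_def g_def z algebra_simps)
  ultimately have 1: "a + g * (3 * M * (1 + x \<bullet> x)) + C * (2 * max 0 (t - t0)) + \<eta> + H x (q + (2 * g) *\<^sub>R x) \<le> 0"
    using sub tQ unfolding visc_sub_def by fastforce
  have "(\<lambda>w. (2 * N) *\<^sub>R (w - z)) (s, y) \<in> superdiff T (\<lambda>t x. - v t x) s y"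
  proof (rule superdiffI[OF C1_grad_square_dist, of "R + 2 - norm y"])
    show "R + 2 - norm y > 0" using y_lt by simp
    fix r k assume "r \<in> {0<..<T}" "dist (r, k) (s, y) < R + 2 - norm y"
    then have "(r, k) \<in> K" by (rule inK)
    then have "\<Phi> (z, (r, k)) \<le> \<Phi> w" using wmax zK by simp
    then show "- v r k - N * (norm ((r, k) - z))\<^sup>2 \<le> - v s y - N * (norm ((s, y) - z))\<^sup>2"
      unfolding \<Phi>w by (simp add: \<Phi>_def V_def z' norm_minus_commute)
  qed
  moreover have "(\<lambda>w. (2 * N) *\<^sub>R (w - z)) (s, y) = (- a, - q)"
    by (simp add: z a_def q_def algebra_simps)
  ultimately have 2: "- a - H y q \<le> 0"
    using super sQ unfolding visc_sub_def by fastforce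
  \<comment> \<open>Shifting the momentum by \<open>2 g x\<close> changes \<open>H\<close> by at
    most \<open>g M (2 |x| + 2 |x|^2)\<close>. The elementary bound
    \<open>2 r + 2 r^2 \<le> 3 (1 + r^2)\<close> is the source of the rate \<open>3 * M\<close> in
    the barrier.\<close>
  have "H x q - H x (q + (2 * g) *\<^sub>R x) \<le> M * (1 + norm x) * norm ((2 * g) *\<^sub>R x)"
    using lip_p[of x q "q + (2 * g) *\<^sub>R x"] by simp
  also have "\<dots> = g * (M * (2 * norm x + 2 * (norm x)\<^sup>2))"
    using g0 by (simp add: algebra_simps power2_eq_square)
  also have "\<dots> \<le> g * (3 * M * (1 + x \<bullet> x))"
  proof -
    have "0 \<le> (norm x - 1)\<^sup>2" by simp
    then have "2 * norm x + 2 * (norm x)\<^sup>2 \<le> 3 * (1 + (norm x)\<^sup>2)" by (simp add: power2_diff)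
    then have "M * (2 * norm x + 2 * (norm x)\<^sup>2) \<le> M * (3 * (1 + (norm x)\<^sup>2))"
      by (rule mult_left_mono[OF _ M])
    then show ?thesis using g0 by (intro mult_left_mono) (simp_all add: power2_norm_eq_inner algebra_simps)
  qed
  finally have 3: "H x q - H x (q + (2 * g) *\<^sub>R x) \<le> g * (3 * M * (1 + x \<bullet> x))" .
  have nq: "norm q = 2 * N * norm (x - y)" using N(1) by (simp add: q_def)
  have "H y q - H x q \<le> M * (1 + norm q) * norm (x - y)"
    using lip_x[of y q x] by (simp add: norm_minus_commute)
  also have "\<dots> = M * (norm (x - y) + 2 * (N * (norm (x - y))\<^sup>2))"
    by (simp add: nq algebra_simps power2_eq_square)
  also have "\<dots> \<le> M * (3 * \<rho>)"
  proof -
    have "norm (x - y) \<le> norm (z - z')" using norm_snd_le[where x = "t - s" and y = "x - y"] by (simp add: z z')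
    then have "N * (norm (x - y))\<^sup>2 \<le> N * (norm (z - z'))\<^sup>2"
      using N(1) by (intro mult_left_mono power_mono) auto
    then show ?thesis using pen\<rho> dxy \<delta>(4) M by (intro mult_left_mono) auto
  qed
  finally have 4: "H y q - H x q \<le> M * (3 * \<rho>)" .
  \<comment> \<open>Adding the two viscosity inequalities, the barrier terms absorb the momentum
    shift and \<open>\<eta> \<le> M * (3 * \<rho>)\<close> would remain.\<close>
  have "C * (2 * max 0 (t - t0)) \<ge> 0" using C0 by simp
  then show False using 1 2 3 4 M\<rho> by linarith
qed

section \<open>Convex Hamiltonians and admissible controls\<close>

text \<open>A sandwich theorem: a hyperplane separating the strict hypograph of the concave function
  from the epigraph of the convex one is the graph of the affine function sought.\<close>

lemma affine_between:
  fixes f g :: "'a::euclidean_space \<Rightarrow> real"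
  assumes f: "convex_on UNIV f" and g: "convex_on UNIV (\<lambda>x. - g x)" and le: "\<And>x. g x \<le> f x"
  obtains v l where "\<And>p. g p \<le> v \<bullet> p - l" "\<And>p. v \<bullet> p - l \<le> f p"
proof -
  define S where "S = {(p, r). r < g p}"
  have "convex S"
    unfolding convex_def
  proof (intro ballI allI impI)
    fix x y :: "'a \<times> real" and u w :: real
    assume *: "x \<in> S" "y \<in> S" "0 \<le> u" "0 \<le> w" "u + w = 1"
    obtain p r q s where xy: "x = (p, r)" "y = (q, s)" by (metis prod.exhaust)
    have rs: "r < g p" "s < g q" using * xy by (auto simp: S_def)
    have "- g (u *\<^sub>R p + w *\<^sub>R q) \<le> u * - g p + w * - g q"
      using g * unfolding convex_on_def by blast
    moreover have "u * r + w * s < u * g p + w * g q"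
    proof (cases "u = 0")
      case True
      then show ?thesis using * rs by simp
    next
      case False
      then have "u * r < u * g p" using * rs by simp
      moreover have "w * s \<le> w * g q" using * rs by (intro mult_left_mono) auto
      ultimately show ?thesis by linarith
    qed
    ultimately show "u *\<^sub>R x + w *\<^sub>R y \<in> S"
      by (simp add: S_def xy)
  qed
  moreover have "convex (epigraph UNIV f)" using f by (rule convex_epigraphI)
  moreover have "(0, g 0 - 1) \<in> S" "(0, f 0) \<in> epigraph UNIV f" by (auto simp: S_def epigraph_def)
  moreover have "S \<inter> epigraph UNIV f = {}"
  proof -
    have False if "r < g p" "f p \<le> r" for p r using le[of p] that by linarith
    then show ?thesis by (auto simp: S_def epigraph_def)
  qed
  ultimately obtain a b where ab: "a \<noteq> 0" "\<forall>x\<in>S. a \<bullet> x \<le> b" "\<forall>x\<in>epigraph UNIV f. b \<le> a \<bullet> x"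
    using separating_hyperplane_sets[of S "epigraph UNIV f"] by blast
  define \<alpha> where "\<alpha> = fst a"
  define \<beta> where "\<beta> = snd a"
  have 1: "\<alpha> \<bullet> p + \<beta> * r \<le> b" if "r < g p" for p r
    using ab(2)[rule_format, of "(p, r)"] that by (auto simp: S_def inner_prod_def \<alpha>_def \<beta>_def)
  have 2: "b \<le> \<alpha> \<bullet> p + \<beta> * r" if "r \<ge> f p" for p r
    using ab(3)[rule_format, of "(p, r)"] that by (auto simp: epigraph_def inner_prod_def \<alpha>_def \<beta>_def)
  have "\<beta> \<ge> 0"
  proof (rule ccontr)
    assume "\<not> \<beta> \<ge> 0"
    then have "\<beta> < 0" by simp
    define r where "r = max (f 0) ((b - 1) / \<beta>)"
    have "\<beta> * r \<le> \<beta> * ((b - 1) / \<beta>)" using \<open>\<beta> < 0\<close> by (intro mult_left_mono_neg) (auto simp: r_def)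
    then have "\<beta> * r \<le> b - 1" using \<open>\<beta> < 0\<close> by simp
    then show False using 2[of 0 r] by (simp add: r_def)
  qed
  \<comment> \<open>Both functions are finite everywhere, so a vertical hyperplane would force the
    linear form \<open>\<alpha>\<close> to be constant, hence zero.\<close>
  moreover have "\<beta> \<noteq> 0"
  proof
    assume "\<beta> = 0"
    then have "\<alpha> \<bullet> p \<le> b" "b \<le> \<alpha> \<bullet> p" for p
      using 1[of "g p - 1" p] 2[of p "f p"] by auto
    then have "\<alpha> \<bullet> \<alpha> = \<alpha> \<bullet> 0" by (metis order_antisym)
    then have "\<alpha> = 0" by simp
    then show False using \<open>\<beta> = 0\<close> ab(1) by (simp add: \<alpha>_def \<beta>_def prod_eq_iff)
  qed
  ultimately have \<beta>: "\<beta> > 0" by simp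
  \<comment> \<open>The hypograph was taken strict to make the sets disjoint; its boundary is
    recovered by letting the gap \<open>e / \<beta>\<close> shrink.\<close>
  have 3: "\<alpha> \<bullet> p + \<beta> * g p \<le> b" for p
  proof (rule field_le_epsilon)
    fix e :: real assume e: "e > 0"
    have "\<alpha> \<bullet> p + \<beta> * (g p - e / \<beta>) \<le> b" using e \<beta> by (intro 1) auto
    then show "\<alpha> \<bullet> p + \<beta> * g p \<le> b + e" using \<beta> by (simp add: algebra_simps)
  qed
  show ?thesis
  proof (rule that[of "- (1 / \<beta>) *\<^sub>R \<alpha>" "- b / \<beta>"])
    show "g p \<le> (- (1 / \<beta>) *\<^sub>R \<alpha>) \<bullet> p - - b / \<beta>" for p
      using 3[of p] \<beta> by (simp add: field_simps)
    show "(- (1 / \<beta>) *\<^sub>R \<alpha>) \<bullet> p - - b / \<beta> \<le> f p" for p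
      using 2[of p "f p"] \<beta> by (simp add: field_simps)
  qed
qed

text \<open>Testing with a long multiple of \<open>v\<close> makes the constant \<open>A\<close>
  negligible; \<open>t\<close> is chosen so that the linear excess is exactly
  \<open>|A| + 1\<close>.\<close>

lemma norm_le_of_linear_bound:
  fixes v :: "'a::real_inner"
  assumes "\<And>p. v \<bullet> p \<le> A + B * norm p" "B \<ge> 0"
  shows "norm v \<le> B"
proof (rule ccontr)
  assume "\<not> norm v \<le> B"
  then have d: "norm v - B > 0" by simp
  then have v: "norm v > 0" using \<open>B \<ge> 0\<close> by linarith
  define t where "t = (\<bar>A\<bar> + 1) / (norm v * (norm v - B))"
  have t: "t > 0" using v d by (simp add: t_def)
  have "t * (norm v * (norm v - B)) = \<bar>A\<bar> + 1" using v d by (simp add: t_def)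
  moreover have "t * (norm v * norm v) \<le> A + B * (t * norm v)"
    using assms(1)[of "t *\<^sub>R v"] t by (simp add: dot_square_norm power2_eq_square)
  ultimately show False by (simp add: algebra_simps)
qed


lemma convex_on_shift_norm:
  fixes a :: "'a::real_normed_vector"
  assumes "K \<ge> 0"
  shows "convex_on UNIV (\<lambda>p. K * norm (p - a))"
  using convex_on_cmul[OF assms convex_on_dist[of UNIV a]] by (simp add: dist_norm norm_minus_commute)

lemma convex_on_affine: "convex_on UNIV (\<lambda>p::'a::real_inner. v \<bullet> p + c)"
proof (rule convex_onI)
  fix t :: real and x y
  show "v \<bullet> ((1 - t) *\<^sub>R x + t *\<^sub>R y) + c \<le> (1 - t) * (v \<bullet> x + c) + t * (v \<bullet> y + c)"
    by (simp add: inner_add_right algebra_simps)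
qed simp

lemma lipschitz_le:
  fixes f :: "'a::real_normed_vector \<Rightarrow> real"
  assumes "L-lipschitz_on UNIV f"
  shows "f x \<le> f y + L * norm (x - y)"
  using lipschitz_onD[OF assms, of x y] by (simp add: dist_norm)

section \<open>Affine minorants of the Hamiltonian as controls\<close>

locale convex_hamiltonian =
  fixes H :: "'a::euclidean_space \<Rightarrow> 'a \<Rightarrow> real" and M :: real
  assumes convex: "\<And>x. convex_on UNIV (H x)"
    and M: "M \<ge> 0"
    and lip_p: "\<And>x p q. \<bar>H x p - H x q\<bar> \<le> M * (1 + norm x) * norm (p - q)"
    and lip_x: "\<And>x y p. \<bar>H x p - H y p\<bar> \<le> M * (1 + norm p) * norm (x - y)"
begin

text \<open>The epigraph of the Lagrangian \<open>L x v = (SUP p. v \<bullet> p - H x p)\<close>, which may take the value \<open>\<infinity>\<close>: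
  pairs of an admissible velocity at \<open>x\<close> and a running cost.\<close>

definition E :: "'a \<Rightarrow> ('a \<times> real) set" where
  "E x = {w. \<forall>p. fst w \<bullet> p - snd w \<le> H x p}"

lemma E_le: "w \<in> E x \<Longrightarrow> fst w \<bullet> p - snd w \<le> H x p"
  by (simp add: E_def)

lemma E_speed:
  assumes "w \<in> E x"
  shows "norm (fst w) \<le> M * (1 + norm x)"
proof (rule norm_le_of_linear_bound)
  fix p
  show "fst w \<bullet> p \<le> (snd w + H x 0) + M * (1 + norm x) * norm p"
    using E_le[OF assms, of p] lip_p[of x p 0] by simp
qed (use M in simp)

lemma E_cost: "w \<in> E x \<Longrightarrow> - H x 0 \<le> snd w"
  using E_le[of w x 0] by simp

text \<open>A subgradient of \<open>H x\<close> at \<open>q\<close>, found between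
  \<open>H x\<close> and the downward cone of slope \<open>M * (1 + |x|)\<close> with apex on its
  graph. Thus \<open>H x\<close> is the maximum of its affine minorants.\<close>

lemma E_attained: "\<exists>w\<in>E x. fst w \<bullet> q - snd w = H x q"
proof -
  have "0 \<le> M * (1 + norm x)" using M by simp
  from convex_on_add[OF convex_on_shift_norm[OF this, of q] convex_on_const[THEN iffD2, of UNIV "- H x q"]]
  have 1: "convex_on UNIV (\<lambda>p. - (H x q - M * (1 + norm x) * norm (p - q)))"
    by (simp add: add.commute)
  have 2: "H x q - M * (1 + norm x) * norm (p - q) \<le> H x p" for p
    using lip_p[of x q p] by (simp add: norm_minus_commute)
  obtain v l where vl: "\<And>p. H x q - M * (1 + norm x) * norm (p - q) \<le> v \<bullet> p - l" "\<And>p. v \<bullet> p - l \<le> H x p"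
    using affine_between[OF convex 1 2] by metis
  show ?thesis
    using vl(2) vl(1)[of q] vl(2)[of q] by (intro bexI[of _ "(v, l)"]) (auto simp: E_def)
qed

text \<open>Lowering an affine minorant of \<open>H x\<close> by \<open>d * (1 + |p|)\<close> gives
  a concave minorant of \<open>H y\<close>. An affine function above it has slope within
  \<open>d\<close> of the old one, and its value at 0 bounds the cost. Working with epigraphs avoids
  any regularity of the possibly infinite Lagrangian.\<close>

lemma E_lipschitz:
  assumes "w \<in> E x"
  shows "\<exists>w'\<in>E y. norm (fst w' - fst w) \<le> M * norm (x - y) \<and> snd w' \<le> snd w + M * norm (x - y)"
proof -
  define d where "d = M * norm (x - y)"
  have d: "d \<ge> 0" using M by (simp add: d_def)
  define g where "g = (\<lambda>p. fst w \<bullet> p - snd w - d - d * norm p)"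
  have "convex_on UNIV (\<lambda>p. - g p)"
    using convex_on_add[OF convex_on_shift_norm[OF d, of 0] convex_on_affine[of "- fst w" "snd w + d"]]
    by (simp add: g_def algebra_simps)
  moreover have "g p \<le> H y p" for p
    using E_le[OF assms, of p] lip_x[of x p y] by (simp add: g_def d_def algebra_simps)
  ultimately obtain v l where vl: "\<And>p. g p \<le> v \<bullet> p - l" "\<And>p. v \<bullet> p - l \<le> H y p"
    using affine_between[OF convex] by metis
  have "norm (fst w - v) \<le> d"
  proof (rule norm_le_of_linear_bound)
    show "(fst w - v) \<bullet> p \<le> (snd w + d - l) + d * norm p" for p
      using vl(1)[of p] by (simp add: g_def inner_diff_left)
  qed (rule d)
  moreover have "l \<le> snd w + d" using vl(1)[of 0] by (simp add: g_def)
  ultimately show ?thesis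
    using vl(2) by (intro bexI[of _ "(v, l)"]) (auto simp: E_def d_def norm_minus_commute)
qed

text \<open>This allows the controls of successive time steps to be averaged into a single one in
  \<open>iter_super\<close>.\<close>

lemma convex_E: "convex (E x)"
  unfolding convex_def
proof (intro ballI allI impI)
  fix w w' :: "'a \<times> real" and a b :: real
  assume *: "w \<in> E x" "w' \<in> E x" "0 \<le> a" "0 \<le> b" "a + b = 1"
  have "a * (fst w \<bullet> p - snd w) + b * (fst w' \<bullet> p - snd w') \<le> a * H x p + b * H x p" for p
    using * E_le by (intro add_mono mult_left_mono) auto
  moreover have "a * H x p + b * H x p = H x p" for p
    using *(5) by (simp flip: distrib_right)
  ultimately show "a *\<^sub>R w + b *\<^sub>R w' \<in> E x"
    by (auto simp: E_def inner_add_left algebra_simps)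
qed

text \<open>One step of the control scheme, a discrete Hopf-Lax formula with the control frozen at
  the arrival point \<open>x\<close>. The real-valued infimum is meaningful because of
  \<open>E_nonempty\<close> and, for Lipschitz \<open>f\<close> and \<open>h \<ge> 0\<close>,
  \<open>step_bdd_below\<close>.\<close>

definition step :: "real \<Rightarrow> ('a \<Rightarrow> real) \<Rightarrow> 'a \<Rightarrow> real" where
  "step h f x = (INF w\<in>E x. f (x - h *\<^sub>R fst w) + h * snd w)"

lemma step_bdd_below:
  assumes "L-lipschitz_on UNIV f" "h \<ge> 0"
  shows "bdd_below ((\<lambda>w. f (x - h *\<^sub>R fst w) + h * snd w) ` E x)"
proof (rule bdd_belowI2)
  fix w assume w: "w \<in> E x"
  have L: "L \<ge> 0" using assms(1) lipschitz_on_nonneg by blast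
  have "f x \<le> f (x - h *\<^sub>R fst w) + L * (h * norm (fst w))"
    using lipschitz_le[OF assms(1), of x "x - h *\<^sub>R fst w"] assms(2) by simp
  also have "L * (h * norm (fst w)) \<le> L * (h * (M * (1 + norm x)))"
    using E_speed[OF w] L assms(2) by (intro mult_left_mono) auto
  finally have "f x - L * (h * (M * (1 + norm x))) \<le> f (x - h *\<^sub>R fst w)" by simp
  moreover have "h * (- H x 0) \<le> h * snd w"
    using E_cost[OF w] assms(2) by (rule mult_left_mono)
  ultimately show "f x - L * (h * (M * (1 + norm x))) + h * (- H x 0) \<le> f (x - h *\<^sub>R fst w) + h * snd w"
    by linarith
qed

lemma E_nonempty: "E x \<noteq> {}"
  using E_attained[of x 0] by blast

lemma step_le:
  assumes "L-lipschitz_on UNIV f" "h \<ge> 0" "w \<in> E x"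
  shows "step h f x \<le> f (x - h *\<^sub>R fst w) + h * snd w"
  unfolding step_def using assms by (intro cINF_lower step_bdd_below)

lemma step_approx:
  assumes "L-lipschitz_on UNIV f" "h \<ge> 0" "e > 0"
  shows "\<exists>w\<in>E x. f (x - h *\<^sub>R fst w) + h * snd w < step h f x + e"
  using cINF_less_iff[OF E_nonempty step_bdd_below[OF assms(1,2)], of x "step h f x + e"] assms(3)
  by (simp add: step_def)

text \<open>A nearly optimal control at \<open>x\<close> is replaced by a nearby control at
  \<open>y\<close>. The distance of the departure points grows at most by the factor
  \<open>1 + h * M\<close>, and the running cost by \<open>h * M * |x - y|\<close>.\<close>

lemma lipschitz_step:
  assumes f: "L-lipschitz_on UNIV f" and h: "h \<ge> 0"
  shows "((1 + h * M) * L + h * M)-lipschitz_on UNIV (step h f)"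
proof -
  have L: "L \<ge> 0" using f lipschitz_on_nonneg by blast
  have *: "step h f y \<le> step h f x + ((1 + h * M) * L + h * M) * norm (x - y)" for x y
  proof (rule field_le_epsilon)
    fix e :: real assume "e > 0"
    then obtain w where w: "w \<in> E x" "f (x - h *\<^sub>R fst w) + h * snd w < step h f x + e"
      using step_approx[OF f h] by blast
    obtain w' where w': "w' \<in> E y" "norm (fst w' - fst w) \<le> M * norm (x - y)"
      "snd w' \<le> snd w + M * norm (x - y)"
      using E_lipschitz[OF w(1)] by blast
    have "norm ((y - h *\<^sub>R fst w') - (x - h *\<^sub>R fst w)) \<le> norm (x - y) + h * norm (fst w' - fst w)"
    proof -
      have eq: "(y - h *\<^sub>R fst w') - (x - h *\<^sub>R fst w) = (y - x) - h *\<^sub>R (fst w' - fst w)"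
        by (simp add: algebra_simps)
      show ?thesis
        unfolding eq using norm_triangle_ineq4[of "y - x" "h *\<^sub>R (fst w' - fst w)"] h
        by (simp add: norm_minus_commute)
    qed
    also have "\<dots> \<le> norm (x - y) + h * (M * norm (x - y))"
      using w'(2) h by (simp add: mult_left_mono)
    finally have "L * norm ((y - h *\<^sub>R fst w') - (x - h *\<^sub>R fst w)) \<le> L * (norm (x - y) + h * (M * norm (x - y)))"
      using L by (rule mult_left_mono)
    then have "f (y - h *\<^sub>R fst w') \<le> f (x - h *\<^sub>R fst w) + L * (norm (x - y) + h * (M * norm (x - y)))"
      using lipschitz_le[OF f, of "y - h *\<^sub>R fst w'" "x - h *\<^sub>R fst w"] by linarith
    moreover have "h * snd w' \<le> h * (snd w + M * norm (x - y))"
      using w'(3) h by (rule mult_left_mono)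
    ultimately show "step h f y \<le> step h f x + ((1 + h * M) * L + h * M) * norm (x - y) + e"
      using step_le[OF f h w'(1)] w(2) by (simp add: algebra_simps)
  qed
  show ?thesis
  proof (rule lipschitz_onI)
    show "dist (step h f x) (step h f y) \<le> ((1 + h * M) * L + h * M) * dist x y" for x y
      using *[of x y] *[of y x] by (simp add: dist_norm norm_minus_commute abs_le_iff)
    show "0 \<le> (1 + h * M) * L + h * M" using h M L by simp
  qed
qed

end

section \<open>The semi-discrete control scheme\<close>

text \<open>An Arzela-Ascoli diagonal argument on a countable dense subset. Equicontinuity is asked
  only for large \<open>n\<close>, since the approximations below jump in time. Division by
  \<open>|B z| + 1\<close> turns pointwise bounds into the uniform bound of the diagonal
  lemma.\<close>

lemma convergent_subsequence_equicontinuous: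
  fixes f :: "nat \<Rightarrow> 'b::{metric_space, second_countable_topology} \<Rightarrow> real"
  assumes bounded: "\<And>n z. z \<in> S \<Longrightarrow> \<bar>f n z\<bar> \<le> B z"
    and equi: "\<And>z e. z \<in> S \<Longrightarrow> e > 0 \<Longrightarrow>
      \<exists>d>0. \<exists>N. \<forall>n\<ge>N. \<forall>z'\<in>S. dist z' z < d \<longrightarrow> \<bar>f n z' - f n z\<bar> < e"
  obtains r :: "nat \<Rightarrow> nat" where "strict_mono r" "\<And>z. z \<in> S \<Longrightarrow> convergent (\<lambda>n. f (r n) z)"
proof -
  obtain D where D: "countable D" "D \<subseteq> S" "S \<subseteq> closure D" using separable by blast
  have "norm (f n z / (\<bar>B z\<bar> + 1)) \<le> 1" if "z \<in> D" for n z
    using bounded[of z n] that D(2) by (auto simp: field_simps)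
  then obtain r :: "nat \<Rightarrow> nat" where r: "strict_mono r"
    "\<And>z. z \<in> D \<Longrightarrow> \<exists>l. (\<lambda>n. f (r n) z / (\<bar>B z\<bar> + 1)) \<longlonglongrightarrow> l"
    using function_convergent_subsequence[of D "\<lambda>n z. f n z / (\<bar>B z\<bar> + 1)" 1] D(1) by blast
  have conv: "Cauchy (\<lambda>n. f (r n) z)" if "z \<in> D" for z
  proof -
    obtain l where "(\<lambda>n. f (r n) z / (\<bar>B z\<bar> + 1)) \<longlonglongrightarrow> l" using r(2) \<open>z \<in> D\<close> by blast
    then have "(\<lambda>n. (f (r n) z / (\<bar>B z\<bar> + 1)) * (\<bar>B z\<bar> + 1)) \<longlonglongrightarrow> l * (\<bar>B z\<bar> + 1)"
      by (intro tendsto_mult tendsto_const)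
    moreover have "\<bar>B z\<bar> + 1 \<noteq> 0" using abs_ge_zero[of "B z"] by linarith
    ultimately have "(\<lambda>n. f (r n) z) \<longlonglongrightarrow> l * (\<bar>B z\<bar> + 1)" by simp
    then show ?thesis using LIMSEQ_imp_Cauchy by blast
  qed
  have "Cauchy (\<lambda>n. f (r n) z)" if z: "z \<in> S" for z
  proof (rule metric_CauchyI)
    fix e :: real assume "e > 0"
    then obtain d N where d: "d > 0" "\<And>n z'. n \<ge> N \<Longrightarrow> z' \<in> S \<Longrightarrow> dist z' z < d \<Longrightarrow> \<bar>f n z' - f n z\<bar> < e / 3"
      using equi[OF z, of "e / 3"] by auto
    obtain z' where z': "z' \<in> D" "dist z' z < d"
      using z D(3) d(1) closure_approachable[of z D] by blast
    obtain N' where N': "\<And>m n. m \<ge> N' \<Longrightarrow> n \<ge> N' \<Longrightarrow> dist (f (r m) z') (f (r n) z') < e / 3"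
      using metric_CauchyD[OF conv[OF z'(1)], of "e / 3"] \<open>e > 0\<close> by auto
    have rn: "\<bar>f (r n) z' - f (r n) z\<bar> < e / 3" if "n \<ge> N" for n
      using that z' D(2) seq_suble[OF r(1), of n] by (intro d(2)) auto
    have "dist (f (r m) z) (f (r n) z) < e" if "m \<ge> max N N'" "n \<ge> max N N'" for m n
    proof -
      have "m \<ge> N" "n \<ge> N" "m \<ge> N'" "n \<ge> N'" using that by auto
      from rn[OF this(1)] rn[OF this(2)] N'[OF this(3,4)] show ?thesis
        unfolding dist_real_def by linarith
    qed
    then show "\<exists>M. \<forall>m\<ge>M. \<forall>n\<ge>M. dist (f (r m) z) (f (r n) z) < e" by blast
  qed
  then show ?thesis using that r(1) Cauchy_convergent by blast
qed

locale lipschitz_scheme = convex_hamiltonian H M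
  for H :: "'a::euclidean_space \<Rightarrow> 'a \<Rightarrow> real" and M :: real +
  fixes g :: "'a \<Rightarrow> real" and L T :: real
  assumes g: "L-lipschitz_on UNIV g" and T: "T > 0"
begin

definition iter :: "real \<Rightarrow> nat \<Rightarrow> 'a \<Rightarrow> real" where
  "iter h k = (step h ^^ k) g"

definition \<Lambda> :: real where "\<Lambda> = exp (M * T) * (L + 1)"

lemma iter_0 [simp]: "iter h 0 = g" and iter_Suc: "iter h (Suc k) = step h (iter h k)"
  by (simp_all add: iter_def)

lemma L_nonneg: "L \<ge> 0"
  using g lipschitz_on_nonneg by blast

lemma \<Lambda>_nonneg: "\<Lambda> \<ge> 0"
  using L_nonneg by (simp add: \<Lambda>_def)

text \<open>By \<open>lipschitz_step\<close>, the Lipschitz constant plus one is multiplied by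
  \<open>1 + h * M\<close> at each step; in the limit this is the exponential in
  \<open>\<Lambda>\<close>.\<close>

lemma iter_lipschitz_power:
  assumes "h \<ge> 0"
  shows "((1 + h * M) ^ k * (L + 1) - 1)-lipschitz_on UNIV (iter h k)"
proof (induction k)
  case (Suc k)
  from lipschitz_step[OF this assms]
  show ?case unfolding iter_Suc by (simp add: algebra_simps)
qed (use g in simp)

lemma iter_lipschitz:
  assumes h: "h \<ge> 0" and k: "h * real k \<le> T"
  shows "\<Lambda>-lipschitz_on UNIV (iter h k)"
proof (rule lipschitz_on_mono[OF iter_lipschitz_power[OF h]])
  have "(1 + h * M) ^ k \<le> exp (h * M) ^ k"
    using h M by (intro power_mono) auto
  also have "\<dots> = exp (M * (h * real k))"
    by (simp add: algebra_simps flip: exp_of_nat_mult)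
  also have "\<dots> \<le> exp (M * T)" using k M by (simp add: mult_left_mono)
  finally have "(1 + h * M) ^ k * (L + 1) \<le> exp (M * T) * (L + 1)"
    using L_nonneg by (intro mult_right_mono) auto
  then show "(1 + h * M) ^ k * (L + 1) - 1 \<le> \<Lambda>" by (simp add: \<Lambda>_def)
qed simp

text \<open>The constant velocity \<open>fst w\<close> is followed for \<open>m\<close> steps. At
  each point of the path, all within \<open>d\<close> of \<open>z\<close>, the control
  \<open>w\<close> is replaced by an admissible one nearby: this costs
  \<open>\<Lambda> * M * d\<close> for the displacement and \<open>M * d\<close> for the running
  cost, per unit of time.\<close>

lemma iter_sub:
  assumes h: "h \<ge> 0" and w: "w \<in> E z"
  shows "h * real (k + m) \<le> T \<Longrightarrow> norm (y - z) + real m * h * norm (fst w) \<le> d \<Longrightarrow>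
    iter h (k + m) (y + (real m * h) *\<^sub>R fst w)
      \<le> iter h k y + real m * h * (snd w + (\<Lambda> + 1) * M * d)"
proof (induction m)
  case (Suc m)
  define Y where "Y = y + (real m * h) *\<^sub>R fst w"
  define X where "X = y + (real (Suc m) * h) *\<^sub>R fst w"
  have XY: "X = Y + h *\<^sub>R fst w" by (simp add: X_def Y_def algebra_simps)
  have "h * real (k + m) \<le> h * real (k + Suc m)" using h by (intro mult_left_mono) auto
  then have hk: "h * real (k + m) \<le> T" using Suc.prems(1) by linarith
  note lip = iter_lipschitz[OF h hk]
  have "real m * h * norm (fst w) \<le> real (Suc m) * h * norm (fst w)"
    using h by (intro mult_right_mono) auto
  then have IH: "iter h (k + m) Y \<le> iter h k y + real m * h * (snd w + (\<Lambda> + 1) * M * d)"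
    using Suc.IH[OF hk] Suc.prems(2) unfolding Y_def by linarith
  have "norm (X - z) \<le> norm (y - z) + norm ((real (Suc m) * h) *\<^sub>R fst w)"
    using norm_triangle_ineq[of "y - z" "(real (Suc m) * h) *\<^sub>R fst w"] by (simp add: X_def algebra_simps)
  then have Xz: "norm (z - X) \<le> d" using Suc.prems(2) h by (simp add: norm_minus_commute)
  obtain w' where w': "w' \<in> E X" "norm (fst w' - fst w) \<le> M * norm (z - X)"
      "snd w' \<le> snd w + M * norm (z - X)"
    using E_lipschitz[OF w] by blast
  have Md: "M * norm (z - X) \<le> M * d" using Xz M by (rule mult_left_mono)
  have "iter h (k + Suc m) X \<le> iter h (k + m) (X - h *\<^sub>R fst w') + h * snd w'"
    using step_le[OF lip h w'(1)] by (simp add: iter_Suc)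
  also have "iter h (k + m) (X - h *\<^sub>R fst w') \<le> iter h (k + m) Y + \<Lambda> * norm ((X - h *\<^sub>R fst w') - Y)"
    by (rule lipschitz_le[OF lip])
  also have "norm ((X - h *\<^sub>R fst w') - Y) = h * norm (fst w' - fst w)"
  proof -
    have "(X - h *\<^sub>R fst w') - Y = - (h *\<^sub>R (fst w' - fst w))"
      by (simp add: XY algebra_simps)
    then show ?thesis using h by (simp only: norm_minus_cancel norm_scaleR abs_of_nonneg)
  qed
  also have "\<Lambda> * (h * norm (fst w' - fst w)) \<le> \<Lambda> * (h * (M * d))"
    using w'(2) Md h \<Lambda>_nonneg by (intro mult_left_mono) auto
  also have "h * snd w' \<le> h * (snd w + M * d)"
    using w'(3) Md h by (intro mult_left_mono) auto
  also note IH
  finally have "iter h (k + Suc m) X \<le> iter h k y + real m * h * (snd w + (\<Lambda> + 1) * M * d)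
      + \<Lambda> * (h * (M * d)) + h * (snd w + M * d)" by simp
  then show ?case unfolding X_def by (simp add: algebra_simps)
qed simp

text \<open>A nearly optimal discrete path is traced back from \<open>y\<close>, its controls are
  transported to \<open>E z\<close> and averaged into a single control. A slack of
  \<open>h * h\<close> per step in the infimum becomes \<open>h\<close> per unit of time.\<close>

lemma iter_super:
  assumes h: "h > 0"
  shows "h * real (k + m) \<le> T \<Longrightarrow> norm (y - z) + real m * h * (M * (1 + norm z)) \<le> d \<Longrightarrow>
    \<exists>w\<in>E z. iter h k (y - (real m * h) *\<^sub>R fst w) + real m * h * (snd w - (\<Lambda> + 1) * M * d - h)
      \<le> iter h (k + m) y"
proof (induction m arbitrary: y)
  case 0
  obtain w where "w \<in> E z" using E_nonempty by blast
  then show ?case by (intro bexI[of _ w]) simp_all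
next
  case (Suc m)
  let ?R = "M * (1 + norm z)"
  have "h * real (k + m) \<le> h * real (k + Suc m)" using h by (intro mult_left_mono) auto
  then have hk: "h * real (k + m) \<le> T" using Suc.prems(1) by linarith
  have h0: "h \<ge> 0" using h by simp
  note lip = iter_lipschitz[OF h0 hk]
  obtain w0 where w0: "w0 \<in> E y" "iter h (k + m) (y - h *\<^sub>R fst w0) + h * snd w0 < iter h (k + Suc m) y + h * h"
    using step_approx[OF lip h0, of "h * h" y] h by (auto simp: iter_Suc)
  obtain w1 where w1: "w1 \<in> E z" "norm (fst w1 - fst w0) \<le> M * norm (y - z)"
    "snd w1 \<le> snd w0 + M * norm (y - z)"
    using E_lipschitz[OF w0(1)] by blast
  have R: "?R \<ge> 0" using M by simp
  have "norm (y - z) \<le> d" using Suc.prems(2) R h by (smt (verit) mult_nonneg_nonneg of_nat_0_le_iff)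
  then have Md: "M * norm (y - z) \<le> M * d" using M by (rule mult_left_mono)
  define y' where "y' = y - h *\<^sub>R fst w1"
  have "iter h (k + m) y' \<le> iter h (k + m) (y - h *\<^sub>R fst w0) + \<Lambda> * norm (y' - (y - h *\<^sub>R fst w0))"
    by (rule lipschitz_le[OF lip])
  also have "norm (y' - (y - h *\<^sub>R fst w0)) = h * norm (fst w1 - fst w0)"
  proof -
    have "y' - (y - h *\<^sub>R fst w0) = - (h *\<^sub>R (fst w1 - fst w0))"
      by (simp add: y'_def algebra_simps)
    then show ?thesis using h by (simp only: norm_minus_cancel norm_scaleR abs_of_nonneg[OF h0])
  qed
  also have "\<Lambda> * (h * norm (fst w1 - fst w0)) \<le> \<Lambda> * (h * (M * d))"
    using w1(2) Md h \<Lambda>_nonneg by (intro mult_left_mono) auto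
  finally have 1: "iter h (k + m) y' \<le> iter h (k + m) (y - h *\<^sub>R fst w0) + \<Lambda> * (h * (M * d))" by simp
  have 2: "h * snd w1 \<le> h * (snd w0 + M * d)" using w1(3) Md h by (intro mult_left_mono) auto
  have "norm (y' - z) \<le> norm (y - z) + h * norm (fst w1)"
    using norm_triangle_ineq4[of "y - z" "h *\<^sub>R fst w1"] h by (simp add: y'_def algebra_simps)
  also have "h * norm (fst w1) \<le> h * ?R" using E_speed[OF w1(1)] h by (intro mult_left_mono) auto
  finally have "norm (y' - z) + real m * h * ?R \<le> d"
    using Suc.prems(2) by (simp add: algebra_simps)
  from Suc.IH[OF hk this] obtain w2 where w2: "w2 \<in> E z"
    "iter h k (y' - (real m * h) *\<^sub>R fst w2) + real m * h * (snd w2 - (\<Lambda> + 1) * M * d - h) \<le> iter h (k + m) y'"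
    by blast
  \<comment> \<open>The most recent control gets weight \<open>1 / (m + 1)\<close>, the average of
    the \<open>m\<close> earlier ones gets the rest; multiplying by the elapsed time then adds the
    displacements and costs of the two pieces.\<close>
  define c where "c = 1 / real (Suc m)"
  have c: "0 \<le> c" "0 \<le> 1 - c" "real (Suc m) * c = 1" "real (Suc m) * (1 - c) = real m"
    by (auto simp: c_def field_simps)
  define w where "w = c *\<^sub>R w1 + (1 - c) *\<^sub>R w2"
  have "w \<in> E z" unfolding w_def using convexD[OF convex_E w1(1) w2(1)] c by simp
  have "(real (Suc m) * h) *\<^sub>R w = h *\<^sub>R ((real (Suc m) * c) *\<^sub>R w1 + (real (Suc m) * (1 - c)) *\<^sub>R w2)"
    unfolding w_def scaleR_add_right scaleR_scaleR by (simp only: mult_ac)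
  also have "\<dots> = h *\<^sub>R w1 + (real m * h) *\<^sub>R w2"
    unfolding c scaleR_add_right by (simp add: mult_ac)
  finally have mw: "(real (Suc m) * h) *\<^sub>R w = h *\<^sub>R w1 + (real m * h) *\<^sub>R w2" .
  have mw1: "(real (Suc m) * h) *\<^sub>R fst w = h *\<^sub>R fst w1 + (real m * h) *\<^sub>R fst w2"
    using arg_cong[OF mw, of fst] by simp
  have mw2: "real (Suc m) * h * snd w = h * snd w1 + real m * h * snd w2"
    using arg_cong[OF mw, of snd] by simp
  have "iter h k (y - (real (Suc m) * h) *\<^sub>R fst w) + real (Suc m) * h * (snd w - (\<Lambda> + 1) * M * d - h)
    = iter h k (y' - (real m * h) *\<^sub>R fst w2) + (h * snd w1 + real m * h * snd w2)
      - real (Suc m) * h * ((\<Lambda> + 1) * M * d + h)"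
    unfolding mw1 mw2[symmetric] by (simp add: y'_def algebra_simps)
  also have "\<dots> \<le> iter h (k + Suc m) y"
    using w0(2) 1 2 w2(2) by (simp add: algebra_simps)
  finally show ?case using \<open>w \<in> E z\<close> by blast
qed

end

text \<open>A one-sided first-order expansion, uniform over directions in a ball. The uniformity
  matters in \<open>limit_subdiff_ge\<close>, where the direction is a velocity that depends on
  \<open>s\<close>.\<close>

lemma superdiff_expansion:
  fixes u :: "real \<Rightarrow> 'a::euclidean_space \<Rightarrow> real"
  assumes D: "D \<in> superdiff T u t x" and t: "t \<in> {0<..<T}" and e: "e > 0"
  obtains s0 where "s0 > 0" "\<And>s d. 0 < s \<Longrightarrow> s < s0 \<Longrightarrow> norm d \<le> B \<Longrightarrow>
    t + s * fst d \<in> {0<..<T} \<and> u (t + s * fst d) (x + s *\<^sub>R snd d) \<le> u t x + s * (D \<bullet> d) + e * s"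
proof -
  obtain phi Dphi r where *: "D = Dphi (t, x)" "C1_grad ({0<..<T} \<times> UNIV) phi Dphi" "r > 0"
    "\<And>s y. s \<in> {0<..<T} \<Longrightarrow> dist (s, y) (t, x) < r \<Longrightarrow>
       u s y - phi (s, y) \<le> u t x - phi (t, x)"
    using D by (elim superdiffE) blast
  have "(phi has_derivative (\<lambda>d. D \<bullet> d)) (at (t, x))"
    using *(1,2) t by (auto simp: C1_grad_inner)
  moreover have "e / (\<bar>B\<bar> + 1) > 0" using e by (simp add: add_nonneg_pos)
  ultimately have "\<exists>d>0. \<forall>z. norm (z - (t, x)) < d \<longrightarrow>
      norm (phi z - phi (t, x) - D \<bullet> (z - (t, x))) \<le> e / (\<bar>B\<bar> + 1) * norm (z - (t, x))"
    unfolding has_derivative_at_alt by blast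
  then obtain \<delta> where \<delta>: "\<delta> > 0" "\<And>z. norm (z - (t, x)) < \<delta> \<Longrightarrow>
      \<bar>phi z - phi (t, x) - D \<bullet> (z - (t, x))\<bar> \<le> e / (\<bar>B\<bar> + 1) * norm (z - (t, x))"
    unfolding real_norm_def by blast
  \<comment> \<open>Dividing by \<open>|B| + 1\<close> keeps every displacement \<open>s * d\<close>
    inside the contact ball, inside the range of the derivative estimate and within the time
    interval.\<close>
  define s0 where "s0 = min (min r \<delta>) (min t (T - t)) / (\<bar>B\<bar> + 1)"
  have min_pos: "min (min r \<delta>) (min t (T - t)) > 0" using *(3) \<delta>(1) t by auto
  show ?thesis
  proof (rule that[of s0])
    show "s0 > 0" unfolding s0_def using min_pos by (intro divide_pos_pos) auto
    fix s and d :: "real \<times> 'a" assume s: "0 < s" "s < s0" "norm d \<le> B"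
    define z where "z = (t + s * fst d, x + s *\<^sub>R snd d)"
    have zd: "z - (t, x) = s *\<^sub>R d" by (simp add: z_def prod_eq_iff)
    have sB: "s * (\<bar>B\<bar> + 1) < min (min r \<delta>) (min t (T - t))"
      using s(2) by (simp add: s0_def pos_less_divide_eq add_nonneg_pos)
    have "norm (s *\<^sub>R d) \<le> s * (\<bar>B\<bar> + 1)" using s by (simp add: mult_left_mono)
    then have small: "norm (z - (t, x)) < min (min r \<delta>) (min t (T - t))"
      unfolding zd using sB by linarith
    have "\<bar>s * fst d\<bar> \<le> norm (z - (t, x))" unfolding zd
      using norm_fst_le[where x = "fst (s *\<^sub>R d)" and y = "snd (s *\<^sub>R d)"]
      unfolding prod.collapse by simp
    then have inQ: "t + s * fst d \<in> {0<..<T}" using small by auto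
    have "u (t + s * fst d) (x + s *\<^sub>R snd d) - phi z \<le> u t x - phi (t, x)"
      unfolding z_def by (rule *(4)[OF inQ]) (use small in \<open>simp add: z_def dist_norm\<close>)
    moreover have "\<bar>phi z - phi (t, x) - D \<bullet> (z - (t, x))\<bar> \<le> e / (\<bar>B\<bar> + 1) * norm (z - (t, x))"
      using small by (intro \<delta>(2)) simp
    moreover have "e / (\<bar>B\<bar> + 1) * norm (z - (t, x)) \<le> e * s"
    proof -
      have "e / (\<bar>B\<bar> + 1) * norm (s *\<^sub>R d) \<le> e / (\<bar>B\<bar> + 1) * (s * (\<bar>B\<bar> + 1))"
        using e s by (intro mult_left_mono) (auto simp: mult_left_mono)
      also have "\<dots> = e * s" using abs_ge_zero[of B] by (simp add: field_simps)
      finally show ?thesis by (simp add: zd)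
    qed
    ultimately show "t + s * fst d \<in> {0<..<T} \<and>
        u (t + s * fst d) (x + s *\<^sub>R snd d) \<le> u t x + s * (D \<bullet> d) + e * s"
      using inQ by (simp add: zd abs_le_iff)
  qed
qed

lemma subdiff_expansion:
  fixes u :: "real \<Rightarrow> 'a::euclidean_space \<Rightarrow> real"
  assumes D: "D \<in> subdiff T u t x" and t: "t \<in> {0<..<T}" and e: "e > 0"
  obtains s0 where "s0 > 0" "\<And>s d. 0 < s \<Longrightarrow> s < s0 \<Longrightarrow> norm d \<le> B \<Longrightarrow>
    t + s * fst d \<in> {0<..<T} \<and> u (t + s * fst d) (x + s *\<^sub>R snd d) \<ge> u t x + s * (D \<bullet> d) - e * s"
proof -
  have "- D \<in> superdiff T (\<lambda>s y. - u s y) t x" using D by (simp add: subdiff_iff)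
  from superdiff_expansion[OF this t e, where B = B] obtain s0 where s0: "s0 > 0"
    "\<And>s d. 0 < s \<Longrightarrow> s < s0 \<Longrightarrow> norm d \<le> B \<Longrightarrow> t + s * fst d \<in> {0<..<T} \<and>
      - u (t + s * fst d) (x + s *\<^sub>R snd d) \<le> - u t x + s * (- D \<bullet> d) + e * s"
    by blast
  then show ?thesis by (intro that[of s0]) fastforce+
qed

section \<open>Interpolation in time and compactness of the scheme\<close>

context lipschitz_scheme
begin

definition mesh :: "nat \<Rightarrow> real" where "mesh n = 1 / (real n + 1)"

definition idx :: "nat \<Rightarrow> real \<Rightarrow> nat" where "idx n t = nat \<lfloor>t * (real n + 1)\<rfloor>"

definition approx :: "nat \<Rightarrow> real \<Rightarrow> 'a \<Rightarrow> real" where "approx n t = iter (mesh n) (idx n t)"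

text \<open>The time that the grid really spends between \<open>s\<close> and \<open>t\<close>,
  within one mesh of \<open>t - s\<close> when \<open>0 \<le> s \<le> t\<close>. By
  \<open>idx_mono\<close> the natural subtraction does not truncate in that case.\<close>

definition gap :: "nat \<Rightarrow> real \<Rightarrow> real \<Rightarrow> real" where "gap n s t = real (idx n t - idx n s) * mesh n"

lemma mesh: "mesh n > 0" "mesh n \<le> 1"
  by (auto simp: mesh_def)

lemma mesh_tendsto: "mesh \<longlonglongrightarrow> 0"
  unfolding mesh_def[abs_def] using LIMSEQ_inverse_real_of_nat by (simp add: inverse_eq_divide add.commute)

lemma idx_bounds:
  assumes "t \<ge> 0"
  shows "mesh n * real (idx n t) \<le> t" "t < mesh n * real (idx n t) + mesh n"
proof -
  have "t * (real n + 1) \<ge> 0" using assms by simp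
  then have "real (idx n t) \<le> t * (real n + 1)" "t * (real n + 1) < real (idx n t) + 1"
    unfolding idx_def by linarith+
  then show "mesh n * real (idx n t) \<le> t" "t < mesh n * real (idx n t) + mesh n"
    by (simp_all add: mesh_def field_simps)
qed

lemma idx_mono: "s \<le> t \<Longrightarrow> idx n s \<le> idx n t"
  unfolding idx_def by (intro nat_mono floor_mono mult_right_mono) auto

lemma idx_gap: "s \<le> t \<Longrightarrow> idx n t = idx n s + (idx n t - idx n s)"
  using idx_mono[of s t n] by simp

lemma gap_bounds:
  assumes "0 \<le> s" "s \<le> t"
  shows "0 \<le> gap n s t" "gap n s t \<le> t" "\<bar>gap n s t - (t - s)\<bar> \<le> mesh n"
proof -
  have g: "gap n s t = mesh n * real (idx n t) - mesh n * real (idx n s)"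
    using idx_mono[OF assms(2), of n] by (simp add: gap_def of_nat_diff algebra_simps)
  show "0 \<le> gap n s t" using mesh(1)[of n] by (simp add: gap_def)
  have "0 \<le> mesh n * real (idx n s)" using mesh(1)[of n] by simp
  then show "gap n s t \<le> t" "\<bar>gap n s t - (t - s)\<bar> \<le> mesh n"
    using idx_bounds[of s n] idx_bounds[of t n] assms g by linarith+
qed

lemma gap_tendsto:
  assumes "0 \<le> s" "s \<le> t"
  shows "(\<lambda>n. gap n s t) \<longlonglongrightarrow> t - s"
proof -
  have "(\<lambda>n. gap n s t - (t - s)) \<longlonglongrightarrow> 0"
    by (rule Lim_null_comparison[OF _ mesh_tendsto]) (use gap_bounds(3)[OF assms] in auto)
  then show ?thesis by (simp add: LIM_zero_iff)
qed

lemma lipschitz_approx: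
  assumes "0 \<le> t" "t \<le> T"
  shows "\<Lambda>-lipschitz_on UNIV (approx n t)"
  unfolding approx_def using idx_bounds(1)[OF assms(1), of n] assms mesh(1)[of n]
  by (intro iter_lipschitz) auto

lemma approx_0 [simp]: "approx n 0 = g"
  by (simp add: approx_def idx_def)

lemma approx_sub:
  assumes st: "0 \<le> s" "s \<le> t" "t \<le> T" and w: "w \<in> E z"
  shows "approx n t (y + gap n s t *\<^sub>R fst w)
    \<le> approx n s y + gap n s t * (snd w + (\<Lambda> + 1) * M * (norm (y - z) + gap n s t * norm (fst w)))"
proof -
  have "mesh n * real (idx n s + (idx n t - idx n s)) \<le> T"
    using idx_bounds(1)[of t n] st by (simp flip: idx_gap[OF st(2)])
  from iter_sub[OF less_imp_le[OF mesh(1)] w this order_refl] show ?thesis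
    unfolding approx_def gap_def by (simp flip: idx_gap[OF st(2)])
qed

lemma approx_super:
  assumes st: "0 \<le> s" "s \<le> t" "t \<le> T"
  shows "\<exists>w\<in>E z. approx n s (z - gap n s t *\<^sub>R fst w)
    + gap n s t * (snd w - (\<Lambda> + 1) * M * (gap n s t * (M * (1 + norm z))) - mesh n) \<le> approx n t z"
proof -
  have "mesh n * real (idx n s + (idx n t - idx n s)) \<le> T"
    using idx_bounds(1)[of t n] st by (simp flip: idx_gap[OF st(2)])
  from iter_super[OF mesh(1) this, of z z] show ?thesis
    unfolding approx_def gap_def by (simp flip: idx_gap[OF st(2)])
qed

text \<open>The constant collected in \<open>approx_time\<close>: running cost, error of freezing
  the control, and displacement times the spatial Lipschitz constant. The final 1 absorbs
  \<open>mesh n\<close>.\<close>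

definition time_lip :: "'a \<Rightarrow> real" where
  "time_lip x = \<bar>H x 0\<bar> + (\<Lambda> + 1) * M * (T * (M * (1 + norm x))) + \<Lambda> * (M * (1 + norm x)) + 1"

lemma time_lip_nonneg: "time_lip x \<ge> 0"
  unfolding time_lip_def using \<Lambda>_nonneg M T by (intro add_nonneg_nonneg mult_nonneg_nonneg) auto

text \<open>The upper bound follows one admissible control, the lower bound a nearly optimal one
  from \<open>approx_super\<close>; in both cases the spatial Lipschitz bound brings the displaced
  point back to \<open>x\<close>.\<close>

lemma approx_time:
  assumes st: "0 \<le> s" "s \<le> t" "t \<le> T"
  shows "\<bar>approx n t x - approx n s x\<bar> \<le> gap n s t * time_lip x"
proof -
  define R where "R = M * (1 + norm x)"
  define G where "G = gap n s t"
  have G: "0 \<le> G" "G \<le> T" using gap_bounds[OF st(1,2), of n] st by (auto simp: G_def)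
  have R: "R \<ge> 0" using M by (simp add: R_def)
  have GR: "G * R \<le> T * R" using G R by (intro mult_right_mono)
  have M': "(\<Lambda> + 1) * M \<ge> 0" using M \<Lambda>_nonneg by simp
  have tl: "time_lip x = \<bar>H x 0\<bar> + (\<Lambda> + 1) * M * (T * R) + \<Lambda> * R + 1"
    by (simp add: time_lip_def R_def)
  have "approx n t x - approx n s x \<le> G * time_lip x"
  proof -
    \<comment> \<open>Attainment at momentum 0 yields a control of cost \<open>- H x 0\<close>, the
      smallest possible by \<open>E_cost\<close>.\<close>
    obtain w where w: "w \<in> E x" "fst w \<bullet> 0 - snd w = H x 0" using E_attained by blast
    have v: "norm (fst w) \<le> R" using E_speed[OF w(1)] by (simp add: R_def)
    have "approx n t x \<le> approx n t (x + G *\<^sub>R fst w) + \<Lambda> * (G * norm (fst w))"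
      using lipschitz_le[OF lipschitz_approx[of t n], of x "x + G *\<^sub>R fst w"] st G by simp
    also have "approx n t (x + G *\<^sub>R fst w) \<le> approx n s x + G * (- H x 0 + (\<Lambda> + 1) * M * (G * norm (fst w)))"
    proof -
      have "snd w = - H x 0" using w(2) by simp
      then show ?thesis using approx_sub[OF st w(1), of n x] by (simp add: G_def)
    qed
    also have "\<dots> \<le> approx n s x + G * (\<bar>H x 0\<bar> + (\<Lambda> + 1) * M * (T * R))"
    proof -
      have "G * norm (fst w) \<le> T * R" using mult_left_mono[OF v G(1)] GR by linarith
      then have "(\<Lambda> + 1) * M * (G * norm (fst w)) \<le> (\<Lambda> + 1) * M * (T * R)"
        using M' by (rule mult_left_mono)
      then show ?thesis using G by (intro add_left_mono mult_left_mono) auto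
    qed
    also have "\<Lambda> * (G * norm (fst w)) \<le> G * (\<Lambda> * R + 1)"
    proof -
      have "\<Lambda> * (G * norm (fst w)) \<le> \<Lambda> * (G * R)" using v G \<Lambda>_nonneg by (intro mult_left_mono) auto
      then show ?thesis using G by (simp add: algebra_simps)
    qed
    finally show ?thesis unfolding tl by (simp add: algebra_simps)
  qed
  moreover have "approx n s x - approx n t x \<le> G * time_lip x"
  proof -
    obtain w where w: "w \<in> E x" "approx n s (x - G *\<^sub>R fst w)
        + G * (snd w - (\<Lambda> + 1) * M * (G * R) - mesh n) \<le> approx n t x"
      using approx_super[OF st, of x n] by (auto simp: G_def R_def)
    have v: "norm (fst w) \<le> R" using E_speed[OF w(1)] by (simp add: R_def)
    have "approx n s x \<le> approx n s (x - G *\<^sub>R fst w) + \<Lambda> * (G * norm (fst w))"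
      using lipschitz_le[OF lipschitz_approx[of s n], of x "x - G *\<^sub>R fst w"] st G by simp
    also have "\<Lambda> * (G * norm (fst w)) \<le> \<Lambda> * (G * R)" using v G \<Lambda>_nonneg by (intro mult_left_mono) auto
    finally have 1: "approx n s x \<le> approx n s (x - G *\<^sub>R fst w) + \<Lambda> * (G * R)" by simp
    have "(\<Lambda> + 1) * M * (G * R) \<le> (\<Lambda> + 1) * M * (T * R)" using GR M' by (rule mult_left_mono)
    then have "- snd w + (\<Lambda> + 1) * M * (G * R) + mesh n \<le> \<bar>H x 0\<bar> + (\<Lambda> + 1) * M * (T * R) + 1"
      using E_cost[OF w(1)] mesh(2)[of n] by linarith
    then have "G * (- snd w + (\<Lambda> + 1) * M * (G * R) + mesh n) \<le> G * (\<bar>H x 0\<bar> + (\<Lambda> + 1) * M * (T * R) + 1)"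
      using G(1) by (rule mult_left_mono)
    then show ?thesis using 1 w(2) unfolding tl by (simp add: algebra_simps)
  qed
  ultimately show ?thesis by (simp add: G_def abs_le_iff)
qed

text \<open>The approximations are piecewise constant in time, hence the extra
  \<open>mesh n\<close>; it makes equicontinuity an asymptotic property.\<close>

lemma approx_time_diff:
  assumes "s \<in> {0..T}" "t \<in> {0..T}"
  shows "\<bar>approx n t x - approx n s x\<bar> \<le> (\<bar>t - s\<bar> + mesh n) * time_lip x"
proof (cases "s \<le> t")
  case True
  then have "gap n s t * time_lip x \<le> (\<bar>t - s\<bar> + mesh n) * time_lip x"
    using gap_bounds(3)[of s t n] assms time_lip_nonneg by (intro mult_right_mono) auto
  then show ?thesis using approx_time[of s t n x] True assms by simp
next
  case False
  then have "gap n t s * time_lip x \<le> (\<bar>t - s\<bar> + mesh n) * time_lip x"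
    using gap_bounds(3)[of t s n] assms time_lip_nonneg by (intro mult_right_mono) auto
  then show ?thesis using approx_time[of t s n x] False assms by (simp add: abs_minus_commute)
qed

lemma approx_convergent_subsequence:
  obtains r u where "strict_mono (r :: nat \<Rightarrow> nat)"
    "\<And>t x. t \<in> {0..T} \<Longrightarrow> (\<lambda>n. approx (r n) t x) \<longlonglongrightarrow> u t x"
proof -
  let ?S = "{0..T} \<times> (UNIV :: 'a set)"
  let ?f = "\<lambda>n z. approx n (fst z) (snd z)"
  have bdd: "\<bar>?f n z\<bar> \<le> \<bar>g (snd z)\<bar> + (T + 1) * time_lip (snd z)" if "z \<in> ?S" for n z
  proof -
    have "(\<bar>fst z - 0\<bar> + mesh n) * time_lip (snd z) \<le> (T + 1) * time_lip (snd z)"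
      using that mesh(2)[of n] time_lip_nonneg by (intro mult_right_mono) auto
    moreover have "\<bar>?f n z - approx n 0 (snd z)\<bar> \<le> (\<bar>fst z - 0\<bar> + mesh n) * time_lip (snd z)"
      using that T by (intro approx_time_diff) auto
    ultimately show ?thesis by simp
  qed
  have equi: "\<exists>d>0. \<exists>N. \<forall>n\<ge>N. \<forall>z'\<in>?S. dist z' z < d \<longrightarrow> \<bar>?f n z' - ?f n z\<bar> < e"
    if z: "z \<in> ?S" and e: "e > 0" for z e
  proof -
    define C where "C = time_lip (snd z)"
    have C: "C \<ge> 0" unfolding C_def by (rule time_lip_nonneg)
    define d where "d = e / (2 * (\<Lambda> + C + 1))"
    have d: "d > 0" using e C \<Lambda>_nonneg by (simp add: d_def)
    have "eventually (\<lambda>n. mesh n < d) sequentially"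
      using mesh_tendsto d by (rule order_tendstoD)
    then obtain N where N: "\<And>n. n \<ge> N \<Longrightarrow> mesh n < d" by (auto simp: eventually_sequentially)
    have "\<bar>?f n z' - ?f n z\<bar> < e" if n: "n \<ge> N" and z': "z' \<in> ?S" "dist z' z < d" for n z'
    proof -
      obtain t x where zt: "z = (t, x)" by (rule prod.exhaust)
      obtain t' x' where zt': "z' = (t', x')" by (rule prod.exhaust)
      have dt: "\<bar>t' - t\<bar> < d" and dx: "norm (x' - x) < d"
        using z'(2) dist_fst_le[of z' z] dist_snd_le[of z' z] by (auto simp: zt zt' dist_norm)
      have "\<bar>approx n t' x' - approx n t' x\<bar> \<le> \<Lambda> * norm (x' - x)"
        using lipschitz_onD[OF lipschitz_approx[of t' n], of x' x] z' by (simp add: zt' dist_norm)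
      moreover have "\<Lambda> * norm (x' - x) \<le> \<Lambda> * d" using dx \<Lambda>_nonneg by (intro mult_left_mono) auto
      moreover have "\<bar>approx n t' x - approx n t x\<bar> \<le> (\<bar>t' - t\<bar> + mesh n) * C"
        using approx_time_diff[of t t' n x] z z' by (simp add: zt zt' C_def)
      moreover have "(\<bar>t' - t\<bar> + mesh n) * C \<le> (d + d) * C"
        using dt N[OF n] C by (intro mult_right_mono) auto
      moreover have "\<Lambda> * d + (d + d) * C < e"
      proof -
        have "\<Lambda> * d + (d + d) * C < d * (2 * (\<Lambda> + C + 1))"
          using d \<Lambda>_nonneg by (simp add: algebra_simps) (smt (verit) mult_nonneg_nonneg)
        also have "\<dots> = e" using C \<Lambda>_nonneg by (simp add: d_def)
        finally show ?thesis .
      qed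
      ultimately show ?thesis unfolding zt zt' fst_conv snd_conv by linarith
    qed
    then show ?thesis using d by blast
  qed
  obtain r where r: "strict_mono (r :: nat \<Rightarrow> nat)" "\<And>z. z \<in> ?S \<Longrightarrow> convergent (\<lambda>n. ?f (r n) z)"
    by (rule convergent_subsequence_equicontinuous[of ?S ?f, OF bdd equi]) blast+
  show ?thesis
  proof (rule that[OF r(1)])
    fix t x assume "t \<in> {0..T}"
    then show "(\<lambda>n. approx (r n) t x) \<longlonglongrightarrow> lim (\<lambda>n. approx (r n) t x)"
      using r(2)[of "(t, x)"] by (simp add: convergent_LIMSEQ_iff)
  qed
qed

end

section \<open>The limit of the scheme\<close>

lemma small_time:
  assumes "e > 0" "s0 > 0"
  obtains s :: real where "0 < s" "s < s0" "C * s \<le> e"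
proof -
  define s where "s = min (s0 / 2) (e / (\<bar>C\<bar> + 1))"
  have s: "0 < s" "s < s0" "s \<le> e / (\<bar>C\<bar> + 1)"
    using assms unfolding s_def by (auto simp: add_nonneg_pos min_less_iff_disj)
  have "C * s \<le> (\<bar>C\<bar> + 1) * s" using s(1) by (intro mult_right_mono) auto
  also have "\<dots> \<le> e" using s(3) by (simp add: pos_le_divide_eq add_nonneg_pos mult.commute)
  finally show ?thesis using that s by blast
qed

locale scheme_limit = lipschitz_scheme H M g L T
  for H :: "'a::euclidean_space \<Rightarrow> 'a \<Rightarrow> real" and M :: real and g L T +
  fixes r :: "nat \<Rightarrow> nat" and u :: "real \<Rightarrow> 'a \<Rightarrow> real"
  assumes r: "strict_mono r"
    and lim: "\<And>t x. t \<in> {0..T} \<Longrightarrow> (\<lambda>n. approx (r n) t x) \<longlonglongrightarrow> u t x"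
begin

lemma limit_0: "u 0 = g"
proof
  fix x
  show "u 0 x = g x" using lim[of 0 x] T by (simp add: LIMSEQ_const_iff)
qed

lemma limit_lipschitz:
  assumes "t \<in> {0..T}"
  shows "\<bar>u t x - u t y\<bar> \<le> \<Lambda> * norm (x - y)"
proof (rule tendsto_upperbound)
  show "(\<lambda>n. \<bar>approx (r n) t x - approx (r n) t y\<bar>) \<longlonglongrightarrow> \<bar>u t x - u t y\<bar>"
    using assms by (intro tendsto_intros lim)
  show "\<forall>\<^sub>F n in sequentially. \<bar>approx (r n) t x - approx (r n) t y\<bar> \<le> \<Lambda> * norm (x - y)"
    using lipschitz_onD[OF lipschitz_approx[of t], of x y] assms
    by (intro always_eventually) (auto simp: dist_norm)
qed simp

lemma mesh_sub_tendsto: "(\<lambda>n. mesh (r n)) \<longlonglongrightarrow> 0"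
  using LIMSEQ_subseq_LIMSEQ[OF mesh_tendsto r] by (simp add: o_def)

lemma gap_sub_tendsto: "0 \<le> s \<Longrightarrow> s \<le> t \<Longrightarrow> (\<lambda>n. gap (r n) s t) \<longlonglongrightarrow> t - s"
  using LIMSEQ_subseq_LIMSEQ[OF gap_tendsto r, of s t] by (simp add: o_def)

lemma limit_time:
  assumes "s \<in> {0..T}" "t \<in> {0..T}"
  shows "\<bar>u t x - u s x\<bar> \<le> \<bar>t - s\<bar> * time_lip x"
proof (rule tendsto_le)
  show "(\<lambda>n. \<bar>approx (r n) t x - approx (r n) s x\<bar>) \<longlonglongrightarrow> \<bar>u t x - u s x\<bar>"
    using assms by (intro tendsto_intros lim)
  have "(\<lambda>n. (\<bar>t - s\<bar> + mesh (r n)) * time_lip x) \<longlonglongrightarrow> (\<bar>t - s\<bar> + 0) * time_lip x"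
    by (intro tendsto_intros mesh_sub_tendsto)
  then show "(\<lambda>n. (\<bar>t - s\<bar> + mesh (r n)) * time_lip x) \<longlonglongrightarrow> \<bar>t - s\<bar> * time_lip x" by simp
qed (use assms approx_time_diff in auto)

lemma continuous_on_limit: "continuous_on ({0..T} \<times> UNIV) (\<lambda>(t, x). u t x)"
  unfolding continuous_on_iff
proof (intro ballI allI impI)
  fix z :: "real \<times> 'a" and e :: real assume z: "z \<in> {0..T} \<times> UNIV" and e: "e > 0"
  obtain t x where zt: "z = (t, x)" by (rule prod.exhaust)
  define C where "C = \<Lambda> + time_lip x"
  have C: "C \<ge> 0" "\<Lambda> \<le> C" "time_lip x \<le> C" using \<Lambda>_nonneg time_lip_nonneg[of x] by (auto simp: C_def)
  define d where "d = e / (2 * (C + 1))"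
  have d: "d > 0" using e C(1) by (simp add: d_def)
  have "dist (case z' of (t, x) \<Rightarrow> u t x) (case z of (t, x) \<Rightarrow> u t x) < e"
    if z': "z' \<in> {0..T} \<times> UNIV" "dist z' z < d" for z'
  proof -
    obtain t' x' where zt': "z' = (t', x')" by (rule prod.exhaust)
    have dt: "\<bar>t' - t\<bar> < d" and dx: "norm (x' - x) < d"
      using z'(2) dist_fst_le[of z' z] dist_snd_le[of z' z] by (auto simp: zt zt' dist_norm)
    have "\<bar>u t' x' - u t' x\<bar> \<le> \<Lambda> * norm (x' - x)"
      using z' by (intro limit_lipschitz) (auto simp: zt')
    moreover have "\<Lambda> * norm (x' - x) \<le> C * d" using dx C \<Lambda>_nonneg by (intro mult_mono) auto
    moreover have "\<bar>u t' x - u t x\<bar> \<le> \<bar>t' - t\<bar> * time_lip x"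
      using z z' by (intro limit_time) (auto simp: zt zt')
    moreover have "\<bar>t' - t\<bar> * time_lip x \<le> d * C" using dt C time_lip_nonneg by (intro mult_mono) auto
    moreover have "C * d + d * C < e"
    proof -
      have "C * d + d * C < d * (2 * (C + 1))" using d by (simp add: algebra_simps)
      also have "\<dots> = e" using C(1) by (simp add: d_def)
      finally show ?thesis .
    qed
    ultimately show ?thesis unfolding zt zt' prod.case dist_real_def by linarith
  qed
  then show "\<exists>d>0. \<forall>z'\<in>{0..T} \<times> UNIV. dist z' z < d \<longrightarrow>
      dist (case z' of (t, x) \<Rightarrow> u t x) (case z of (t, x) \<Rightarrow> u t x) < e"
    using d by blast
qed

text \<open>The dynamic programming inequality in the limit. Its error term is of second order in
  \<open>t - s\<close> when \<open>y\<close> lies within O(t - s) of \<open>z\<close>, which is the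
  case in both applications.\<close>

lemma limit_sub:
  assumes st: "0 \<le> s" "s \<le> t" "t \<le> T" and w: "w \<in> E z"
  shows "u t (y + (t - s) *\<^sub>R fst w)
    \<le> u s y + (t - s) * (snd w + (\<Lambda> + 1) * M * (norm (y - z) + (t - s) * norm (fst w)))"
proof (rule tendsto_le)
  let ?G = "\<lambda>n. gap (r n) s t"
  show "(\<lambda>n. approx (r n) t (y + (t - s) *\<^sub>R fst w)) \<longlonglongrightarrow> u t (y + (t - s) *\<^sub>R fst w)"
    using st by (intro lim) auto
  \<comment> \<open>The last summand accounts for the endpoint, since the scheme travels for time
    \<open>?G n\<close> rather than \<open>t - s\<close>; it tends to 0.\<close>
  have "(\<lambda>n. approx (r n) s y + ?G n * (snd w + (\<Lambda> + 1) * M * (norm (y - z) + ?G n * norm (fst w)))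
      + \<Lambda> * (\<bar>(t - s) - ?G n\<bar> * norm (fst w)))
    \<longlonglongrightarrow> u s y + (t - s) * (snd w + (\<Lambda> + 1) * M * (norm (y - z) + (t - s) * norm (fst w)))
      + \<Lambda> * (\<bar>(t - s) - (t - s)\<bar> * norm (fst w))"
    using st by (intro tendsto_intros gap_sub_tendsto lim) auto
  then show "(\<lambda>n. approx (r n) s y + ?G n * (snd w + (\<Lambda> + 1) * M * (norm (y - z) + ?G n * norm (fst w)))
      + \<Lambda> * (\<bar>(t - s) - ?G n\<bar> * norm (fst w)))
    \<longlonglongrightarrow> u s y + (t - s) * (snd w + (\<Lambda> + 1) * M * (norm (y - z) + (t - s) * norm (fst w)))"
    by simp
  show "\<forall>\<^sub>F n in sequentially. approx (r n) t (y + (t - s) *\<^sub>R fst w)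
    \<le> approx (r n) s y + ?G n * (snd w + (\<Lambda> + 1) * M * (norm (y - z) + ?G n * norm (fst w)))
      + \<Lambda> * (\<bar>(t - s) - ?G n\<bar> * norm (fst w))"
  proof (intro always_eventually allI)
    fix n
    have "(y + (t - s) *\<^sub>R fst w) - (y + ?G n *\<^sub>R fst w) = ((t - s) - ?G n) *\<^sub>R fst w"
      by (simp add: algebra_simps)
    then have "approx (r n) t (y + (t - s) *\<^sub>R fst w)
      \<le> approx (r n) t (y + ?G n *\<^sub>R fst w) + \<Lambda> * (\<bar>(t - s) - ?G n\<bar> * norm (fst w))"
      using lipschitz_le[OF lipschitz_approx[of t "r n"], of "y + (t - s) *\<^sub>R fst w" "y + ?G n *\<^sub>R fst w"] st
      by simp
    then show "approx (r n) t (y + (t - s) *\<^sub>R fst w)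
    \<le> approx (r n) s y + ?G n * (snd w + (\<Lambda> + 1) * M * (norm (y - z) + ?G n * norm (fst w)))
      + \<Lambda> * (\<bar>(t - s) - ?G n\<bar> * norm (fst w))"
      using approx_sub[OF st w, of "r n" y] by linarith
  qed
qed simp

text \<open>Costs in \<open>E z\<close> have no upper bound, so the cost is first weakened to its
  lower bound \<open>v \<bullet> p - H z p\<close> for one fixed \<open>p\<close>. Only the
  velocities remain, and they range over a compact ball, so a subsequence converges.\<close>

lemma limit_super:
  assumes st: "0 \<le> s" "s \<le> t" "t \<le> T"
  shows "\<exists>v. norm v \<le> M * (1 + norm z) \<and>
    u s (z - (t - s) *\<^sub>R v)
      + (t - s) * (v \<bullet> p - H z p - (\<Lambda> + 1) * M * ((t - s) * (M * (1 + norm z)))) \<le> u t z"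
proof -
  let ?R = "M * (1 + norm z)"
  let ?G = "\<lambda>n. gap (r n) s t"
  have "\<exists>v. norm v \<le> ?R \<and> approx (r n) s (z - ?G n *\<^sub>R v)
      + ?G n * (v \<bullet> p - H z p - (\<Lambda> + 1) * M * (?G n * ?R) - mesh (r n)) \<le> approx (r n) t z" for n
  proof -
    obtain w where w: "w \<in> E z" "approx (r n) s (z - ?G n *\<^sub>R fst w)
      + ?G n * (snd w - (\<Lambda> + 1) * M * (?G n * ?R) - mesh (r n)) \<le> approx (r n) t z"
      using approx_super[OF st] by blast
    have "?G n * (fst w \<bullet> p - H z p - (\<Lambda> + 1) * M * (?G n * ?R) - mesh (r n))
        \<le> ?G n * (snd w - (\<Lambda> + 1) * M * (?G n * ?R) - mesh (r n))"
      using E_le[OF w(1), of p] gap_bounds(1)[OF st(1,2), of "r n"] by (intro mult_left_mono) auto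
    then show ?thesis using w(2) E_speed[OF w(1)] by (intro exI[of _ "fst w"]) linarith
  qed
  then obtain V where V: "\<And>n. norm (V n) \<le> ?R" "\<And>n. approx (r n) s (z - ?G n *\<^sub>R V n)
      + ?G n * (V n \<bullet> p - H z p - (\<Lambda> + 1) * M * (?G n * ?R) - mesh (r n)) \<le> approx (r n) t z"
    by metis
  have "\<forall>n. V n \<in> cball 0 ?R" using V(1) by simp
  then obtain v q where v: "v \<in> cball 0 ?R" "strict_mono (q :: nat \<Rightarrow> nat)" "(V \<circ> q) \<longlonglongrightarrow> v"
    using seq_compactE[OF compact_imp_seq_compact[OF compact_cball]] by metis
  have q: "(\<lambda>n. X (q n)) \<longlonglongrightarrow> l" if "X \<longlonglongrightarrow> l" for X :: "nat \<Rightarrow> real" and l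
    using LIMSEQ_subseq_LIMSEQ[OF that v(2)] by (simp add: o_def)
  have Vq: "(\<lambda>n. V (q n)) \<longlonglongrightarrow> v" using v(3) by (simp add: o_def)
  have Gq: "(\<lambda>n. ?G (q n)) \<longlonglongrightarrow> t - s" using q[OF gap_sub_tendsto] st by simp
  have "u s (z - (t - s) *\<^sub>R v)
      + (t - s) * (v \<bullet> p - H z p - (\<Lambda> + 1) * M * ((t - s) * ?R) - 0)
      - \<Lambda> * norm ((t - s) *\<^sub>R v - (t - s) *\<^sub>R v) \<le> u t z"
  proof (rule tendsto_le)
    show "(\<lambda>n. approx (r (q n)) t z) \<longlonglongrightarrow> u t z" using q[OF lim] st by simp
    have "(\<lambda>n. approx (r (q n)) s (z - (t - s) *\<^sub>R v)) \<longlonglongrightarrow> u s (z - (t - s) *\<^sub>R v)"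
      using q[OF lim] st by simp
    then show "(\<lambda>n. approx (r (q n)) s (z - (t - s) *\<^sub>R v)
      + ?G (q n) * (V (q n) \<bullet> p - H z p - (\<Lambda> + 1) * M * (?G (q n) * ?R) - mesh (r (q n)))
      - \<Lambda> * norm (?G (q n) *\<^sub>R V (q n) - (t - s) *\<^sub>R v)) \<longlonglongrightarrow>
      u s (z - (t - s) *\<^sub>R v)
      + (t - s) * (v \<bullet> p - H z p - (\<Lambda> + 1) * M * ((t - s) * ?R) - 0)
      - \<Lambda> * norm ((t - s) *\<^sub>R v - (t - s) *\<^sub>R v)"
      by (intro tendsto_intros Gq Vq q[OF mesh_sub_tendsto])
    show "\<forall>\<^sub>F n in sequentially. approx (r (q n)) s (z - (t - s) *\<^sub>R v)
      + ?G (q n) * (V (q n) \<bullet> p - H z p - (\<Lambda> + 1) * M * (?G (q n) * ?R) - mesh (r (q n)))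
      - \<Lambda> * norm (?G (q n) *\<^sub>R V (q n) - (t - s) *\<^sub>R v) \<le> approx (r (q n)) t z"
    proof (intro always_eventually allI)
      fix n
      have "(z - (t - s) *\<^sub>R v) - (z - ?G (q n) *\<^sub>R V (q n)) = ?G (q n) *\<^sub>R V (q n) - (t - s) *\<^sub>R v"
        by simp
      then have "approx (r (q n)) s (z - (t - s) *\<^sub>R v) \<le> approx (r (q n)) s (z - ?G (q n) *\<^sub>R V (q n))
          + \<Lambda> * norm (?G (q n) *\<^sub>R V (q n) - (t - s) *\<^sub>R v)"
        using lipschitz_le[OF lipschitz_approx[of s "r (q n)"],
            of "z - (t - s) *\<^sub>R v" "z - ?G (q n) *\<^sub>R V (q n)"] st by simp
      then show "approx (r (q n)) s (z - (t - s) *\<^sub>R v)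
        + ?G (q n) * (V (q n) \<bullet> p - H z p - (\<Lambda> + 1) * M * (?G (q n) * ?R) - mesh (r (q n)))
        - \<Lambda> * norm (?G (q n) *\<^sub>R V (q n) - (t - s) *\<^sub>R v) \<le> approx (r (q n)) t z"
        using V(2)[of "q n"] by linarith
    qed
  qed simp
  then show ?thesis using v(1) by (intro exI[of _ v]) simp
qed

text \<open>The control attaining \<open>H x\<close> at the momentum \<open>snd D\<close> is
  followed along a path that ends at \<open>(t, x)\<close>. Contact from above at its starting point
  turns \<open>limit_sub\<close> into the inequality after division by \<open>s\<close>.\<close>

lemma limit_superdiff:
  assumes t: "t \<in> {0<..<T}" and D: "D \<in> superdiff T u t x"
  shows "fst D + H x (snd D) \<le> 0"
proof (rule field_le_epsilon)
  fix e :: real assume e: "e > 0"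
  obtain w where w: "w \<in> E x" "fst w \<bullet> snd D - snd w = H x (snd D)" using E_attained by blast
  define d where "d = (- 1 :: real, - fst w)"
  \<comment> \<open>The factor 2 appears because the path starts at distance
    \<open>s * norm (fst w)\<close> from the anchor \<open>x\<close> and then travels the same
    distance.\<close>
  define C where "C = (\<Lambda> + 1) * M * (2 * norm (fst w))"
  obtain s0 where s0: "s0 > 0" "\<And>s d'. 0 < s \<Longrightarrow> s < s0 \<Longrightarrow> norm d' \<le> norm d \<Longrightarrow>
    t + s * fst d' \<in> {0<..<T} \<and> u (t + s * fst d') (x + s *\<^sub>R snd d') \<le> u t x + s * (D \<bullet> d') + e / 2 * s"
    using superdiff_expansion[OF D t, of "e / 2" "norm d"] e by auto
  obtain s where s: "0 < s" "s < s0" "C * s \<le> e / 2"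
    using small_time[of "e / 2" s0 C] e s0(1) by auto
  have 1: "t - s \<in> {0<..<T}" "u (t - s) (x - s *\<^sub>R fst w) \<le> u t x + s * (D \<bullet> d) + e / 2 * s"
    using s0(2)[OF s(1,2), of d] by (auto simp: d_def)
  have 2: "u t x \<le> u (t - s) (x - s *\<^sub>R fst w) + s * (snd w + C * s)"
    using limit_sub[of "t - s" t w x "x - s *\<^sub>R fst w", OF _ _ _ w(1)] 1(1) t s(1)
    by (simp add: C_def algebra_simps)
  have Dd: "D \<bullet> d = - fst D - fst w \<bullet> snd D"
    by (simp add: d_def inner_prod_def inner_commute)
  have Hw: "H x (snd D) = fst w \<bullet> snd D - snd w" using w(2) by simp
  have "s * (fst D + H x (snd D)) \<le> s * (C * s + e / 2)"
    using 1(2) 2 unfolding Dd Hw by (simp add: algebra_simps)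
  then have "fst D + H x (snd D) \<le> C * s + e / 2" using s(1) by simp
  then show "fst D + H x (snd D) \<le> 0 + e" using s(3) by simp
qed

text \<open>The same control is now followed on a path that starts at \<open>(t, x)\<close>, and
  contact from below is used at its later endpoint. The path starts at the anchor, so
  \<open>C\<close> carries no factor 2.\<close>

lemma limit_subdiff_le:
  assumes t: "t \<in> {0<..<T}" and D: "D \<in> subdiff T u t x"
  shows "fst D + H x (snd D) \<le> 0"
proof (rule field_le_epsilon)
  fix e :: real assume e: "e > 0"
  obtain w where w: "w \<in> E x" "fst w \<bullet> snd D - snd w = H x (snd D)" using E_attained by blast
  define d where "d = (1 :: real, fst w)"
  define C where "C = (\<Lambda> + 1) * M * norm (fst w)"
  obtain s0 where s0: "s0 > 0" "\<And>s d'. 0 < s \<Longrightarrow> s < s0 \<Longrightarrow> norm d' \<le> norm d \<Longrightarrow>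
    t + s * fst d' \<in> {0<..<T} \<and> u (t + s * fst d') (x + s *\<^sub>R snd d') \<ge> u t x + s * (D \<bullet> d') - e / 2 * s"
    using subdiff_expansion[OF D t, of "e / 2" "norm d"] e by auto
  obtain s where s: "0 < s" "s < s0" "C * s \<le> e / 2"
    using small_time[of "e / 2" s0 C] e s0(1) by auto
  have 1: "t + s \<in> {0<..<T}" "u (t + s) (x + s *\<^sub>R fst w) \<ge> u t x + s * (D \<bullet> d) - e / 2 * s"
    using s0(2)[OF s(1,2), of d] by (auto simp: d_def)
  have 2: "u (t + s) (x + s *\<^sub>R fst w) \<le> u t x + s * (snd w + C * s)"
    using limit_sub[of t "t + s" w x x, OF _ _ _ w(1)] 1(1) t s(1)
    by (simp add: C_def algebra_simps)
  have Dd: "D \<bullet> d = fst D + fst w \<bullet> snd D"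
    by (simp add: d_def inner_prod_def inner_commute)
  have Hw: "H x (snd D) = fst w \<bullet> snd D - snd w" using w(2) by simp
  have "s * (fst D + H x (snd D)) \<le> s * (C * s + e / 2)"
    using 1(2) 2 unfolding Dd Hw by (simp add: algebra_simps)
  then have "fst D + H x (snd D) \<le> C * s + e / 2" using s(1) by simp
  then show "fst D + H x (snd D) \<le> 0 + e" using s(3) by simp
qed

text \<open>\<open>limit_super\<close> with \<open>p = snd D\<close> provides a velocity into the
  past for each small \<open>s\<close>; contact from below at the point reached gives the reverse
  inequality up to O(s).\<close>

lemma limit_subdiff_ge:
  assumes t: "t \<in> {0<..<T}" and D: "D \<in> subdiff T u t x"
  shows "fst D + H x (snd D) \<ge> 0"
proof -
  have "- (fst D + H x (snd D)) \<le> 0"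
  proof (rule field_le_epsilon)
    fix e :: real assume e: "e > 0"
    define R where "R = M * (1 + norm x)"
    define C where "C = (\<Lambda> + 1) * M * R"
    obtain s0 where s0: "s0 > 0" "\<And>s d'. 0 < s \<Longrightarrow> s < s0 \<Longrightarrow> norm d' \<le> 1 + R \<Longrightarrow>
      t + s * fst d' \<in> {0<..<T} \<and> u (t + s * fst d') (x + s *\<^sub>R snd d') \<ge> u t x + s * (D \<bullet> d') - e / 2 * s"
      using subdiff_expansion[OF D t, of "e / 2" "1 + R"] e by auto
    obtain s where s: "0 < s" "s < min s0 t" "C * s \<le> e / 2"
      using small_time[of "e / 2" "min s0 t" C] e s0(1) t by auto
    obtain v where v: "norm v \<le> R" "u (t - s) (x - s *\<^sub>R v)
        + s * (v \<bullet> snd D - H x (snd D) - C * s) \<le> u t x"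
      using limit_super[of "t - s" t x "snd D"] s t by (auto simp: R_def C_def algebra_simps)
    define d where "d = (- 1 :: real, - v)"
    have "norm d \<le> 1 + R" using norm_Pair_le[of "- 1 :: real" "- v"] v(1) by (simp add: d_def)
    then have 1: "u (t - s) (x - s *\<^sub>R v) \<ge> u t x + s * (D \<bullet> d) - e / 2 * s"
      using s0(2)[OF s(1), of d] s(2) by (auto simp: d_def)
    have Dd: "D \<bullet> d = - fst D - v \<bullet> snd D"
      by (simp add: d_def inner_prod_def inner_commute)
    have "s * (- (fst D + H x (snd D))) \<le> s * (C * s + e / 2)"
      using 1 v(2) unfolding Dd by (simp add: algebra_simps)
    then have "- (fst D + H x (snd D)) \<le> C * s + e / 2" using s(1) mult_le_cancel_left_pos by blast
    then show "- (fst D + H x (snd D)) \<le> 0 + e" using s(3) by simp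
  qed
  then show ?thesis by simp
qed

lemma forward_visc_limit: "forward_visc H T u"
  unfolding forward_visc_def
  using continuous_on_limit limit_superdiff limit_subdiff_ge by fastforce

end

section \<open>Stability and existence\<close>

lemma C1_grad_continuous: "C1_grad S phi D \<Longrightarrow> continuous_on S phi"
  unfolding C1_grad_inner
  by (meson continuous_at_imp_continuous_on has_derivative_continuous)

text \<open>Adding \<open>|z - z0|^2\<close> to the test function makes the contact strict, so a
  close approximant attains its maximum inside the ball, and continuity of \<open>G\<close> yields a
  contradiction there. Approximation on compact sets is what finite propagation provides.\<close>

lemma visc_sub_stable:
  fixes u :: "real \<Rightarrow> 'a::euclidean_space \<Rightarrow> real"
  assumes G: "continuous_on UNIV (\<lambda>(x, D). G x D)"
    and approx: "\<And>\<eta> K. \<eta> > 0 \<Longrightarrow> compact K \<Longrightarrow> K \<subseteq> {0..T} \<times> UNIV \<Longrightarrow>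
      \<exists>v. continuous_on ({0..T} \<times> UNIV) (\<lambda>(t, x). v t x) \<and> visc_sub T G v \<and>
          (\<forall>(t, x)\<in>K. \<bar>v t x - u t x\<bar> \<le> \<eta>)"
  shows "visc_sub T G u"
  unfolding visc_sub_def
proof (intro ballI allI, rule ccontr)
  fix t x D assume t: "t \<in> {0<..<T}" and D: "D \<in> superdiff T u t x" and contra: "\<not> G x D \<le> 0"
  obtain phi Dphi e where phi: "D = Dphi (t, x)" "C1_grad ({0<..<T} \<times> UNIV) phi Dphi" "e > 0"
    "\<And>s y. s \<in> {0<..<T} \<Longrightarrow> dist (s, y) (t, x) < e \<Longrightarrow>
       u s y - phi (s, y) \<le> u t x - phi (t, x)"
    using D by (elim superdiffE) blast
  define z0 where "z0 = (t, x)"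
  let ?Q = "{0<..<T} \<times> (UNIV :: 'a set)"
  define P where "P = (\<lambda>z. G (snd z) (Dphi z + (2 * 1) *\<^sub>R (z - z0)))"
  have "continuous_on ?Q (\<lambda>z. (snd z, Dphi z + (2 * 1) *\<^sub>R (z - z0)))"
    using phi(2) unfolding C1_grad_inner by (intro continuous_intros) auto
  from continuous_on_compose2[OF G this]
  have cP: "continuous_on ?Q P" by (simp add: P_def)
  have z0Q: "z0 \<in> ?Q" and oQ: "open ?Q" using t by (auto simp: z0_def open_Times)
  have "P z0 > 0" using contra phi(1) by (simp add: P_def z0_def)
  moreover have "isCont P z0" using cP z0Q oQ continuous_on_eq_continuous_at by blast
  ultimately have "\<forall>\<^sub>F z in nhds z0. P z > 0"
    by (metis isCont_def tendsto_at_iff_tendsto_nhds order_tendstoD(1))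
  moreover have "\<forall>\<^sub>F z in nhds z0. z \<in> ?Q" using oQ z0Q by (rule eventually_nhds_in_open)
  ultimately obtain \<delta> where \<delta>: "\<delta> > 0" "\<And>z. dist z z0 < \<delta> \<Longrightarrow> P z > 0 \<and> z \<in> ?Q"
    unfolding eventually_nhds_metric by (meson dual_order.strict_trans2 linorder_le_less_linear not_less_iff_gr_or_eq)
  define r where "r = min \<delta> e / 2"
  have r: "r > 0" "r < \<delta>" "r < e" using \<delta>(1) phi(3) by (auto simp: r_def)
  define K where "K = cball z0 r"
  have "K \<subseteq> ?Q"
  proof
    fix z assume "z \<in> K"
    then have "dist z z0 < \<delta>" using r(2) by (simp add: K_def dist_commute)
    then show "z \<in> ?Q" using \<delta>(2) by blast
  qed
  then have K: "compact K" "K \<subseteq> ?Q" "z0 \<in> K"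
    using r(1) by (simp_all add: K_def)
  have KT: "K \<subseteq> {0..T} \<times> UNIV" using K(2) by auto
  \<comment> \<open>Two errors of this size leave the maximiser \<open>z1\<close> with squared
    distance at most \<open>r^2 / 2\<close> from \<open>z0\<close>, so it is interior.\<close>
  have "r\<^sup>2 / 4 > 0" using r(1) by simp
  from approx[OF this K(1) KT] obtain v where v: "continuous_on ({0..T} \<times> UNIV) (\<lambda>(t, x). v t x)"
    "visc_sub T G v" "\<And>z. z \<in> K \<Longrightarrow> \<bar>v (fst z) (snd z) - u (fst z) (snd z)\<bar> \<le> r\<^sup>2 / 4"
    by (auto simp: case_prod_unfold)
  define psi where "psi = (\<lambda>z. phi z + 1 * (norm (z - z0))\<^sup>2)"
  have psi: "C1_grad ?Q psi (\<lambda>z. Dphi z + (2 * 1) *\<^sub>R (z - z0))"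
    unfolding psi_def by (intro C1_grad_add phi(2) C1_grad_square_dist)
  have "continuous_on K (\<lambda>z. v (fst z) (snd z) - psi z)"
    using continuous_on_subset[OF v(1) KT] continuous_on_subset[OF C1_grad_continuous[OF psi] K(2)]
    by (intro continuous_on_diff) (simp_all add: case_prod_unfold)
  then obtain z1 where z1: "z1 \<in> K" "\<And>z. z \<in> K \<Longrightarrow> v (fst z) (snd z) - psi z \<le> v (fst z1) (snd z1) - psi z1"
    using continuous_attains_sup[OF K(1)] K(3) by blast
  have "u (fst z1) (snd z1) - phi (fst z1, snd z1) \<le> u t x - phi (t, x)"
    using z1(1) K(2) r(3) by (intro phi(4)) (auto simp: K_def z0_def dist_commute)
  moreover have "v t x - phi (t, x) \<le> v (fst z1) (snd z1) - (phi z1 + (norm (z1 - z0))\<^sup>2)"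
    using z1(2)[OF K(3)] by (simp add: psi_def z0_def)
  moreover have "\<bar>v t x - u t x\<bar> \<le> r\<^sup>2 / 4"
    using v(3)[OF K(3)] unfolding z0_def fst_conv snd_conv .
  ultimately have "(norm (z1 - z0))\<^sup>2 \<le> r\<^sup>2 / 2"
    using v(3)[OF z1(1)] unfolding prod.collapse by linarith
  also have "\<dots> < r\<^sup>2" using r(1) by simp
  finally have z1r: "norm (z1 - z0) < r" using r(1) by (simp add: power_less_imp_less_base)
  obtain t1 x1 where z1t: "z1 = (t1, x1)" by (rule prod.exhaust)
  have "(\<lambda>z. Dphi z + (2 * 1) *\<^sub>R (z - z0)) (t1, x1) \<in> superdiff T v t1 x1"
  proof (rule superdiffI[OF psi, of "r - norm (z1 - z0)"])
    show "r - norm (z1 - z0) > 0" using z1r by simp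
    fix s y assume "s \<in> {0<..<T}" "dist (s, y) (t1, x1) < r - norm (z1 - z0)"
    moreover have "norm (z1 - z0) = dist z0 z1" "dist (s, y) (t1, x1) = dist z1 (s, y)"
      by (simp add: dist_norm norm_minus_commute, simp add: z1t dist_commute)
    ultimately have "dist z0 (s, y) \<le> r"
      using dist_triangle[of z0 "(s, y)" z1] by linarith
    then have "(s, y) \<in> K" by (simp add: K_def)
    then show "v s y - psi (s, y) \<le> v t1 x1 - psi (t1, x1)"
      using z1(2) z1t by fastforce
  qed
  then have "P z1 \<le> 0"
    using v(2) z1(1) K(2) unfolding visc_sub_def P_def z1t by auto
  moreover have "P z1 > 0" using \<delta>(2)[of z1] z1r r(2) by (simp add: dist_norm)
  ultimately show False by simp
qed

text \<open>Inf-convolution of \<open>g\<close> with a steep cone.\<close>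

lemma lipschitz_approximation:
  fixes g :: "'a::real_normed_vector \<Rightarrow> real"
  assumes g: "continuous_on K g" and K: "compact K" "K \<noteq> {}" and e: "e > 0"
  obtains L g' where "L-lipschitz_on UNIV g'" "\<And>x. x \<in> K \<Longrightarrow> \<bar>g' x - g x\<bar> \<le> e"
proof -
  obtain B where B: "\<And>x. x \<in> K \<Longrightarrow> \<bar>g x\<bar> \<le> B"
    using compact_imp_bounded[OF compact_continuous_image[OF g K(1)]] unfolding bounded_iff by auto
  have B0: "B \<ge> 0" using B K(2) by (meson abs_ge_zero ex_in_conv order_trans)
  obtain d where d: "d > 0" "\<And>x y. x \<in> K \<Longrightarrow> y \<in> K \<Longrightarrow> dist y x < d \<Longrightarrow> dist (g y) (g x) < e"
    using compact_uniformly_continuous[OF g K(1)] e unfolding uniformly_continuous_on_def by metis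
  \<comment> \<open>Within distance \<open>d\<close> uniform continuity gives the error
    \<open>e\<close>; beyond it the cone adds at least \<open>2 * B\<close>, the largest possible
    oscillation of \<open>g\<close> on \<open>K\<close>.\<close>
  define N where "N = 2 * B / d"
  have N: "N \<ge> 0" "N * d = 2 * B" using B0 d(1) by (auto simp: N_def)
  define g' where "g' = (\<lambda>x. INF y\<in>K. g y + N * norm (x - y))"
  have bdd: "bdd_below ((\<lambda>y. g y + N * norm (x - y)) ` K)" for x
  proof (rule bdd_belowI2)
    fix y assume "y \<in> K"
    then show "- B \<le> g y + N * norm (x - y)"
      using B[of y] mult_nonneg_nonneg[OF N(1) norm_ge_zero[of "x - y"]] by linarith
  qed
  have *: "g' x \<le> g' y + N * norm (x - y)" for x y
  proof -
    have "g' x - N * norm (x - y) \<le> (INF z\<in>K. g z + N * norm (y - z))"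
    proof (rule cINF_greatest[OF K(2)])
      fix z assume z: "z \<in> K"
      have "g' x \<le> g z + N * norm (x - z)" unfolding g'_def by (rule cINF_lower[OF bdd z])
      also have "N * norm (x - z) \<le> N * (norm (x - y) + norm (y - z))"
        using N(1) norm_triangle_ineq[of "x - y" "y - z"] by (intro mult_left_mono) auto
      finally show "g' x - N * norm (x - y) \<le> g z + N * norm (y - z)" by (simp add: algebra_simps)
    qed
    then show ?thesis by (simp add: g'_def)
  qed
  show ?thesis
  proof (rule that[of N g'])
    show "N-lipschitz_on UNIV g'"
    proof (rule lipschitz_onI[OF _ N(1)])
      show "dist (g' x) (g' y) \<le> N * dist x y" for x y
        using *[of x y] *[of y x] by (simp add: dist_norm norm_minus_commute abs_le_iff)
    qed
    fix x assume x: "x \<in> K"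
    have "g' x \<le> g x + N * norm (x - x)" unfolding g'_def by (rule cINF_lower[OF bdd x])
    moreover have "g x - e \<le> g' x"
      unfolding g'_def
    proof (rule cINF_greatest[OF K(2)])
      fix y assume y: "y \<in> K"
      show "g x - e \<le> g y + N * norm (x - y)"
      proof (cases "dist y x < d")
        case True
        then show ?thesis
          using d(2)[OF x y] mult_nonneg_nonneg[OF N(1) norm_ge_zero[of "x - y"]]
          unfolding dist_real_def by linarith
      next
        case False
        then have "N * d \<le> N * norm (x - y)"
          using N(1) by (intro mult_left_mono) (auto simp: dist_norm norm_minus_commute)
        then show ?thesis using B[OF x] B[OF y] N(2) e by linarith
      qed
    qed
    ultimately show "\<bar>g' x - g x\<bar> \<le> e" using e by (simp add: abs_le_iff)
  qed
qed

lemma continuous_on_time_slice: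
  assumes "continuous_on ({0..T} \<times> UNIV) (\<lambda>(t, x). u t x)" "t \<in> {0..T}"
  shows "continuous_on UNIV (u t)"
proof -
  have "continuous_on UNIV (\<lambda>x. (t, x))"
    by (intro continuous_on_Pair continuous_on_const continuous_on_id)
  moreover have "range (\<lambda>x. (t, x)) \<subseteq> {0..T} \<times> UNIV" using assms(2) by auto
  ultimately have "continuous_on UNIV (\<lambda>x. (\<lambda>(t, x). u t x) (t, x))"
    by (rule continuous_on_compose2[OF assms(1)])
  then show ?thesis by simp
qed

lemma continuous_on_space_slice:
  assumes "continuous_on ({0..T} \<times> UNIV) (\<lambda>(t, x). u t x)"
  shows "continuous_on {0..T} (\<lambda>t. u t x)"
proof -
  have "continuous_on {0..T} (\<lambda>t. (t, x))"
    by (intro continuous_on_Pair continuous_on_const continuous_on_id)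
  moreover have "(\<lambda>t. (t, x)) ` {0..T} \<subseteq> {0..T} \<times> UNIV" by auto
  ultimately have "continuous_on {0..T} (\<lambda>t. (\<lambda>(t, x). u t x) (t, x))"
    by (rule continuous_on_compose2[OF assms])
  then show ?thesis by simp
qed

lemma visc_sub_cong:
  assumes "\<And>t x. t \<in> {0<..<T} \<Longrightarrow> u t x = u' t x"
  shows "visc_sub T G u \<longleftrightarrow> visc_sub T G u'"
proof -
  have "superdiff T u t x = superdiff T u' t x" if "t \<in> {0<..<T}" for t x
    using superdiff_cong[OF that] assms by blast
  then show ?thesis by (simp add: visc_sub_def)
qed

section \<open>Comparison, uniqueness and existence for continuous data\<close>

context convex_hamiltonian
begin

text \<open>The local principle reaches times before \<open>T\<close>; the final time follows by
  continuity from the left.\<close>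

lemma comparison:
  assumes cu: "continuous_on ({0..T} \<times> UNIV) (\<lambda>(t, x). u t x)"
    and cv: "continuous_on ({0..T} \<times> UNIV) (\<lambda>(t, x). v t x)"
    and sub: "visc_sub T (\<lambda>x D. fst D + H x (snd D)) u"
    and super: "visc_sub T (\<lambda>x D. fst D - H x (- snd D)) (\<lambda>t x. - v t x)"
    and t: "t \<in> {0..T}" and T: "T > 0"
    and init: "\<And>y. norm y \<le> exp (3 * M * T) * (1 + (norm x)\<^sup>2) + 2 \<Longrightarrow> u 0 y \<le> v 0 y + c"
  shows "u t x \<le> v t x + c"
proof -
  have *: "u t x - v t x \<le> c" if "t \<in> {0..<T}" for t
  proof -
    have "u t x \<le> v t x + c"
      by (rule comparison_local[OF M lip_p lip_x cu cv sub super that]) (rule init)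
    then show ?thesis by simp
  qed
  show ?thesis
  proof (cases "t < T")
    case True
    then show ?thesis using *[of t] t by simp
  next
    case False
    then have "t = T" using t by simp
    from continuous_on_space_slice[OF cu] continuous_on_space_slice[OF cv]
    have "continuous_on {0..T} (\<lambda>s. u s x - v s x)" by (rule continuous_on_diff)
    then have "((\<lambda>s. u s x - v s x) \<longlongrightarrow> u T x - v T x) (at_left T)"
      using T by (rule continuous_on_Icc_at_leftD)
    moreover have "\<forall>\<^sub>F s in at_left T. u s x - v s x \<le> c"
      using eventually_at_left_real[OF T] by eventually_elim (auto intro: *)
    ultimately have "u T x - v T x \<le> c" by (rule tendsto_upperbound) simp
    then show ?thesis by (simp add: \<open>t = T\<close>)
  qed
qed

lemma forward_visc_le:
  assumes "forward_visc H T u" "forward_visc H T v" "t \<in> {0..T}" "T > 0"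
    and "\<And>y. norm y \<le> exp (3 * M * T) * (1 + (norm x)\<^sup>2) + 2 \<Longrightarrow> u 0 y \<le> v 0 y + c"
  shows "u t x \<le> v t x + c"
proof -
  have "continuous_on ({0..T} \<times> UNIV) (\<lambda>(t, x). u t x)" "visc_sub T (\<lambda>x D. fst D + H x (snd D)) u"
    "continuous_on ({0..T} \<times> UNIV) (\<lambda>(t, x). v t x)"
    "visc_sub T (\<lambda>x D. fst D - H x (- snd D)) (\<lambda>t x. - v t x)"
    using assms(1,2) by (simp_all add: forward_visc_iff)
  from comparison[OF this(1,3,2,4) assms(3,4)] assms(5) show ?thesis by blast
qed

lemma forward_visc_unique:
  assumes "forward_visc H T u" "forward_visc H T v" "u 0 = v 0" "T > 0" "t \<in> {0..T}"
  shows "u t x = v t x"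
  using forward_visc_le[OF assms(1,2,5,4), of x 0] forward_visc_le[OF assms(2,1,5,4), of x 0] assms(3)
  by simp

text \<open>This says \<open>a + H x p \<le> 0\<close> on the subdifferentials of \<open>u\<close>, which are the negated superdifferentials of \<open>- u\<close>.\<close>

definition barron_jensen :: "real \<Rightarrow> (real \<Rightarrow> 'a \<Rightarrow> real) \<Rightarrow> bool" where
  "barron_jensen T u \<longleftrightarrow> visc_sub T (\<lambda>x D. - fst D + H x (- snd D)) (\<lambda>t x. - u t x)"

lemma exists_forward_visc_lipschitz:
  assumes "L-lipschitz_on UNIV g" "T > 0"
  shows "\<exists>u. forward_visc H T u \<and> u 0 = g \<and> barron_jensen T u"
proof -
  interpret lipschitz_scheme H M g L T by unfold_locales (use assms in auto)
  obtain r u where ru: "strict_mono r" "\<And>t x. t \<in> {0..T} \<Longrightarrow> (\<lambda>n. approx (r n) t x) \<longlonglongrightarrow> u t x"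
    using approx_convergent_subsequence by blast
  interpret scheme_limit H M g L T r u by unfold_locales (use ru in auto)
  have "barron_jensen T u"
    unfolding barron_jensen_def visc_sub_uminus using limit_subdiff_le by simp
  then show ?thesis using forward_visc_limit limit_0 by blast
qed

lemma continuous_hamiltonian: "continuous_on UNIV (\<lambda>(x, p). H x p)"
  unfolding continuous_on_def
proof
  fix z :: "'a \<times> 'a"
  let ?f = "\<lambda>z'. M * (1 + norm (fst z')) * norm (snd z' - snd z) + M * (1 + norm (snd z)) * norm (fst z' - fst z)"
  have "((\<lambda>z'. (case z' of (x, p) \<Rightarrow> H x p) - (case z of (x, p) \<Rightarrow> H x p)) \<longlongrightarrow> 0) (at z)"
  proof (rule Lim_null_comparison)
    show "\<forall>\<^sub>F z' in at z. norm ((case z' of (x, p) \<Rightarrow> H x p) - (case z of (x, p) \<Rightarrow> H x p)) \<le> ?f z'"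
    proof (intro always_eventually allI)
      fix z'
      show "norm ((case z' of (x, p) \<Rightarrow> H x p) - (case z of (x, p) \<Rightarrow> H x p)) \<le> ?f z'"
        using lip_p[of "fst z'" "snd z'" "snd z"] lip_x[of "fst z'" "snd z" "fst z"]
        unfolding case_prod_unfold real_norm_def by linarith
    qed
    have "(?f \<longlongrightarrow> M * (1 + norm (fst z)) * norm (snd z - snd z) + M * (1 + norm (snd z)) * norm (fst z - fst z)) (at z)"
      by (intro tendsto_intros)
    then show "(?f \<longlongrightarrow> 0) (at z)" by simp
  qed
  then show "((\<lambda>(x, p). H x p) \<longlongrightarrow> (case z of (x, p) \<Rightarrow> H x p)) (at z)"
    by (simp add: LIM_zero_iff)
qed

lemma continuous_on_hamiltonian: "continuous_on S f \<Longrightarrow> continuous_on S h \<Longrightarrow> continuous_on S (\<lambda>z. H (f z) (h z))"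
  using continuous_on_compose2[OF continuous_hamiltonian, of S "\<lambda>z. (f z, h z)"]
  by (simp add: continuous_on_Pair)

text \<open>The data are approximated by Lipschitz functions on growing balls. By finite propagation
  the corresponding solutions are Cauchy uniformly on bounded sets, and stability passes all three
  viscosity inequalities to the limit.\<close>

lemma exists_forward_visc:
  assumes g: "continuous_on UNIV g" and T: "T > 0"
  shows "\<exists>u. forward_visc H T u \<and> u 0 = g \<and> barron_jensen T u"
proof -
  have "\<forall>n. \<exists>v. forward_visc H T v \<and> barron_jensen T v \<and>
      (\<forall>x\<in>cball 0 (real n). \<bar>v 0 x - g x\<bar> \<le> 1 / (real n + 1))"
  proof
    fix n
    have "continuous_on (cball 0 (real n)) g" using g continuous_on_subset by blast
    then obtain L g' where "L-lipschitz_on UNIV g'" "\<And>x. x \<in> cball 0 (real n) \<Longrightarrow> \<bar>g' x - g x\<bar> \<le> 1 / (real n + 1)"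
      by (rule lipschitz_approximation[of "cball 0 (real n)" g "1 / (real n + 1)"]) auto
    then show "\<exists>v. forward_visc H T v \<and> barron_jensen T v \<and>
        (\<forall>x\<in>cball 0 (real n). \<bar>v 0 x - g x\<bar> \<le> 1 / (real n + 1))"
      using exists_forward_visc_lipschitz[of L g' T] T by blast
  qed
  from choice[OF this] obtain U where "\<forall>n. forward_visc H T (U n) \<and> barron_jensen T (U n) \<and>
      (\<forall>x\<in>cball 0 (real n). \<bar>U n 0 x - g x\<bar> \<le> 1 / (real n + 1))" ..
  then have U: "\<And>n. forward_visc H T (U n)" "\<And>n. barron_jensen T (U n)"
    "\<And>n x. norm x \<le> real n \<Longrightarrow> \<bar>U n 0 x - g x\<bar> \<le> 1 / (real n + 1)"
    by auto
  \<comment> \<open>The radius of the initial ball whose data control the solution at points of norm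
    \<open>b\<close>, as in \<open>comparison\<close>.\<close>
  define \<rho> where "\<rho> = (\<lambda>b. exp (3 * M * T) * (1 + b\<^sup>2) + 2)"
  have le: "U n t x \<le> U m t x + (1 / (real n + 1) + 1 / (real m + 1))"
    if "t \<in> {0..T}" "\<rho> (norm x) \<le> real n" "\<rho> (norm x) \<le> real m" for n m t x
  proof (rule forward_visc_le[OF U(1) U(1) that(1) T])
    fix y :: 'a assume "norm y \<le> exp (3 * M * T) * (1 + (norm x)\<^sup>2) + 2"
    then have "norm y \<le> real n" "norm y \<le> real m" using that by (auto simp: \<rho>_def)
    from U(3)[OF this(1)] U(3)[OF this(2)]
    show "U n 0 y \<le> U m 0 y + (1 / (real n + 1) + 1 / (real m + 1))" by linarith
  qed
  have inv: "(\<lambda>n. 1 / (real n + 1)) \<longlonglongrightarrow> 0"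
    using LIMSEQ_inverse_real_of_nat by (simp add: inverse_eq_divide add.commute)
  have inv_mono: "1 / (real n + 1) \<le> 1 / (real N + 1)" if "N \<le> n" for n N
    using that by (intro divide_left_mono) auto
  have "Cauchy (\<lambda>n. U n t x)" if t: "t \<in> {0..T}" for t x
  proof (rule metric_CauchyI)
    fix e :: real assume "e > 0"
    then have "\<forall>\<^sub>F n in sequentially. 1 / (real n + 1) < e / 2"
      using order_tendstoD(2)[OF inv, of "e / 2"] by simp
    then obtain N1 where N1: "1 / (real N1 + 1) < e / 2" by (auto simp: eventually_sequentially)
    obtain N2 where N2: "\<rho> (norm x) \<le> real N2" using real_arch_simple by blast
    have "dist (U m t x) (U n t x) < e" if "m \<ge> max N1 N2" "n \<ge> max N1 N2" for m n
    proof -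
      have "\<rho> (norm x) \<le> real m" "\<rho> (norm x) \<le> real n" using that N2 by auto
      then have "\<bar>U m t x - U n t x\<bar> \<le> 1 / (real n + 1) + 1 / (real m + 1)"
        using le[OF t, of x m n] le[OF t, of x n m] by linarith
      moreover have "1 / (real n + 1) < e / 2" "1 / (real m + 1) < e / 2"
        using inv_mono[of N1 n] inv_mono[of N1 m] that N1 by auto
      ultimately show ?thesis unfolding dist_real_def by linarith
    qed
    then show "\<exists>N. \<forall>m\<ge>N. \<forall>n\<ge>N. dist (U m t x) (U n t x) < e" by blast
  qed
  then have conv: "(\<lambda>n. U n t x) \<longlonglongrightarrow> lim (\<lambda>n. U n t x)" if "t \<in> {0..T}" for t x
    using that Cauchy_convergent convergent_LIMSEQ_iff by blast
  define u where "u = (\<lambda>t x. lim (\<lambda>n. U n t x))"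
  have near: "\<bar>U n t x - u t x\<bar> \<le> 1 / (real n + 1)" if t: "t \<in> {0..T}" and n: "\<rho> (norm x) \<le> real n" for n t x
  proof (rule tendsto_le)
    show "(\<lambda>m. \<bar>U n t x - U m t x\<bar>) \<longlonglongrightarrow> \<bar>U n t x - u t x\<bar>"
      unfolding u_def by (intro tendsto_intros conv t)
    have "(\<lambda>m. 1 / (real n + 1) + 1 / (real m + 1)) \<longlonglongrightarrow> 1 / (real n + 1) + 0"
      by (intro tendsto_add tendsto_const inv)
    then show "(\<lambda>m. 1 / (real n + 1) + 1 / (real m + 1)) \<longlonglongrightarrow> 1 / (real n + 1)" by simp
    have "\<bar>U n t x - U m t x\<bar> \<le> 1 / (real n + 1) + 1 / (real m + 1)" if "m \<ge> n" for m
      using le[OF t n, of m] le[OF t, of x m n] n that by (simp add: abs_le_iff)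
    then show "\<forall>\<^sub>F m in sequentially. \<bar>U n t x - U m t x\<bar> \<le> 1 / (real n + 1) + 1 / (real m + 1)"
      by (auto simp: eventually_sequentially)
  qed simp
  have uniform: "\<exists>n. \<forall>t\<in>{0..T}. \<forall>x. norm x \<le> b \<longrightarrow> \<bar>U n t x - u t x\<bar> \<le> \<eta>" if "\<eta> > 0" for b \<eta>
  proof -
    have "\<forall>\<^sub>F n in sequentially. 1 / (real n + 1) < \<eta>"
      using order_tendstoD(2)[OF inv that] .
    then obtain N1 where N1: "1 / (real N1 + 1) < \<eta>" by (auto simp: eventually_sequentially)
    obtain N2 where N2: "\<rho> b \<le> real N2" using real_arch_simple by blast
    define n where "n = max N1 N2"
    have "\<bar>U n t x - u t x\<bar> \<le> \<eta>" if "t \<in> {0..T}" "norm x \<le> b" for t x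
    proof -
      have "(norm x)\<^sup>2 \<le> b\<^sup>2" using that(2) by (intro power_mono) auto
      then have "\<rho> (norm x) \<le> \<rho> b" unfolding \<rho>_def by (intro add_right_mono mult_left_mono) auto
      then have "\<rho> (norm x) \<le> real n" using N2 by (simp add: n_def)
      from near[OF that(1) this] show ?thesis using inv_mono[of N1 n] N1 by (simp add: n_def)
    qed
    then show ?thesis by blast
  qed
  have cU: "continuous_on ({0..T} \<times> UNIV) (\<lambda>(t, x). U n t x)" for n
    using U(1) by (simp add: forward_visc_iff)
  have cu: "continuous_on ({0..T} \<times> UNIV) (\<lambda>(t, x). u t x)"
    unfolding continuous_on_iff
  proof (intro ballI allI impI)
    fix z :: "real \<times> 'a" and e :: real assume z: "z \<in> {0..T} \<times> UNIV" and e: "e > 0"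
    have e4: "e / 4 > 0" using e by simp
    obtain n where n: "\<And>t x. t \<in> {0..T} \<Longrightarrow> norm x \<le> norm (snd z) + 1 \<Longrightarrow> \<bar>U n t x - u t x\<bar> \<le> e / 4"
      using uniform[OF e4, of "norm (snd z) + 1"] by blast
    obtain d where d: "d > 0" "\<And>z'. z' \<in> {0..T} \<times> UNIV \<Longrightarrow> dist z' z < d \<Longrightarrow>
        dist (case z' of (t, x) \<Rightarrow> U n t x) (case z of (t, x) \<Rightarrow> U n t x) < e / 4"
      using cU[of n, unfolded continuous_on_iff, rule_format, OF z e4] by blast
    have "dist (case z' of (t, x) \<Rightarrow> u t x) (case z of (t, x) \<Rightarrow> u t x) < e"
      if z': "z' \<in> {0..T} \<times> UNIV" "dist z' z < min d 1" for z'
    proof -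
      have "norm (snd z') \<le> norm (snd z) + 1"
        using z'(2) dist_snd_le[of z' z] norm_triangle_ineq2[of "snd z'" "snd z"] by (simp add: dist_norm)
      then have "\<bar>U n (fst z') (snd z') - u (fst z') (snd z')\<bar> \<le> e / 4" using z'(1) by (intro n) auto
      moreover have "\<bar>U n (fst z) (snd z) - u (fst z) (snd z)\<bar> \<le> e / 4" using z by (intro n) auto
      moreover have "\<bar>U n (fst z') (snd z') - U n (fst z) (snd z)\<bar> < e / 4"
        using d(2)[OF z'(1)] z'(2) by (simp add: case_prod_unfold dist_real_def)
      ultimately show ?thesis unfolding case_prod_unfold dist_real_def using e by linarith
    qed
    then show "\<exists>d>0. \<forall>z'\<in>{0..T} \<times> UNIV. dist z' z < d \<longrightarrow>
        dist (case z' of (t, x) \<Rightarrow> u t x) (case z of (t, x) \<Rightarrow> u t x) < e"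
      using d(1) by (intro exI[of _ "min d 1"]) auto
  qed
  have uniform_K: "\<exists>n. \<forall>(t, x)\<in>K. \<bar>U n t x - u t x\<bar> \<le> \<eta>"
    if \<eta>: "\<eta> > 0" and K: "compact K" "K \<subseteq> {0..T} \<times> UNIV" for \<eta> K
  proof -
    obtain b where b: "\<And>z. z \<in> K \<Longrightarrow> norm z \<le> b"
      using compact_imp_bounded[OF K(1)] unfolding bounded_iff by blast
    have "norm x \<le> b \<and> t \<in> {0..T}" if "(t, x) \<in> K" for t x
      using b[OF that] norm_snd_le[where x = t and y = x] K(2) that by auto
    moreover obtain n where "\<forall>t\<in>{0..T}. \<forall>x. norm x \<le> b \<longrightarrow> \<bar>U n t x - u t x\<bar> \<le> \<eta>"
      using uniform[OF \<eta>, of b] by blast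
    ultimately show ?thesis by blast
  qed
  have "visc_sub T (\<lambda>x D. fst D + H x (snd D)) u"
  proof (rule visc_sub_stable)
    show "continuous_on UNIV (\<lambda>(x, D). fst D + H x (snd D))"
      unfolding case_prod_unfold by (intro continuous_intros continuous_on_hamiltonian)
    show "\<exists>v. continuous_on ({0..T} \<times> UNIV) (\<lambda>(t, x). v t x) \<and>
        visc_sub T (\<lambda>x D. fst D + H x (snd D)) v \<and> (\<forall>(t, x)\<in>K. \<bar>v t x - u t x\<bar> \<le> \<eta>)"
      if "\<eta> > 0" "compact K" "K \<subseteq> {0..T} \<times> UNIV" for \<eta> K
      using uniform_K[OF that] U(1) unfolding forward_visc_iff by blast
  qed
  \<comment> \<open>Shared by the supersolution inequality and the Barron-Jensen inequality, which
    differ only in \<open>G\<close>.\<close>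
  moreover have neg: "visc_sub T G (\<lambda>t x. - u t x)"
    if G: "continuous_on UNIV (\<lambda>(x, D). G x D)" and GU: "\<And>n. visc_sub T G (\<lambda>t x. - U n t x)" for G
  proof (rule visc_sub_stable[OF G])
    fix \<eta> :: real and K :: "(real \<times> 'a) set"
    assume "\<eta> > 0" "compact K" "K \<subseteq> {0..T} \<times> UNIV"
    from uniform_K[OF this] obtain n where n: "\<forall>(t, x)\<in>K. \<bar>U n t x - u t x\<bar> \<le> \<eta>" by blast
    have "continuous_on ({0..T} \<times> UNIV) (\<lambda>(t, x). - U n t x)"
      using continuous_on_minus[OF cU[of n]] by (simp add: case_prod_unfold)
    moreover have "\<forall>(t, x)\<in>K. \<bar>- U n t x - - u t x\<bar> \<le> \<eta>" using n by (auto simp: abs_minus_commute)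
    ultimately show "\<exists>v. continuous_on ({0..T} \<times> UNIV) (\<lambda>(t, x). v t x) \<and> visc_sub T G v \<and>
          (\<forall>(t, x)\<in>K. \<bar>v t x - - u t x\<bar> \<le> \<eta>)"
      using GU by blast
  qed
  have "visc_sub T (\<lambda>x D. fst D - H x (- snd D)) (\<lambda>t x. - u t x)"
  proof (rule neg)
    show "continuous_on UNIV (\<lambda>(x, D). fst D - H x (- snd D))"
      unfolding case_prod_unfold by (intro continuous_intros continuous_on_hamiltonian)
  qed (use U(1) in \<open>simp add: forward_visc_iff\<close>)
  moreover have "visc_sub T (\<lambda>x D. - fst D + H x (- snd D)) (\<lambda>t x. - u t x)"
  proof (rule neg)
    show "continuous_on UNIV (\<lambda>(x, D). - fst D + H x (- snd D))"
      unfolding case_prod_unfold by (intro continuous_intros continuous_on_hamiltonian)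
  qed (use U(2) in \<open>simp add: barron_jensen_def\<close>)
  moreover have "u 0 = g"
  proof
    fix x :: 'a
    obtain N where N: "norm x \<le> real N" using real_arch_simple by blast
    have "\<forall>\<^sub>F n in sequentially. norm (U n 0 x - g x) \<le> 1 / (real n + 1)"
      unfolding eventually_sequentially using N U(3) by (intro exI[of _ N]) auto
    then have "(\<lambda>n. U n 0 x - g x) \<longlonglongrightarrow> 0" by (rule Lim_null_comparison) (rule inv)
    then have "(\<lambda>n. U n 0 x) \<longlonglongrightarrow> g x" by (simp add: LIM_zero_iff)
    moreover have "(\<lambda>n. U n 0 x) \<longlonglongrightarrow> u 0 x" unfolding u_def using T by (intro conv) simp
    ultimately show "u 0 x = g x" using LIMSEQ_unique by blast
  qed
  ultimately show ?thesis
    using cu by (intro exI[of _ u]) (auto simp: forward_visc_iff barron_jensen_def)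
qed

text \<open>The solution constructed from the initial slice of \<open>u\<close> has the property,
  and uniqueness identifies it with \<open>u\<close>.\<close>

lemma forward_visc_barron_jensen:
  assumes u: "forward_visc H T u" and T: "T > 0"
  shows "barron_jensen T u"
proof -
  have "continuous_on UNIV (u 0)"
    using u T continuous_on_time_slice[of T u 0] by (simp add: forward_visc_iff)
  then obtain v where v: "forward_visc H T v" "v 0 = u 0" "barron_jensen T v"
    using exists_forward_visc T by blast
  have "u t x = v t x" if "t \<in> {0<..<T}" for t x
    using forward_visc_unique[OF u v(1)] v(2) T that by simp
  then show ?thesis
    using v(3) visc_sub_cong[of T "\<lambda>t x. - u t x" "\<lambda>t x. - v t x"] by (simp add: barron_jensen_def)
qed

lemma reflected: "convex_hamiltonian (\<lambda>x p. H x (- p)) M"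
proof
  show "convex_on UNIV (\<lambda>p. H x (- p))" for x
  proof (rule convex_onI)
    fix t :: real and a b :: 'a assume "0 < t" "t < 1"
    then have "H x ((1 - t) *\<^sub>R (- a) + t *\<^sub>R (- b)) \<le> (1 - t) * H x (- a) + t * H x (- b)"
      using convex_onD[OF convex[of x], of t "- a" "- b"] by simp
    moreover have "(1 - t) *\<^sub>R (- a) + t *\<^sub>R (- b) = - ((1 - t) *\<^sub>R a + t *\<^sub>R b)" by simp
    ultimately show "H x (- ((1 - t) *\<^sub>R a + t *\<^sub>R b)) \<le> (1 - t) * H x (- a) + t * H x (- b)"
      by (simp only:)
  qed simp
  show "\<bar>H x (- p) - H x (- q)\<bar> \<le> M * (1 + norm x) * norm (p - q)" for x p q
    using lip_p[of x "- p" "- q"] by (simp add: norm_minus_commute)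
  show "\<bar>H x (- p) - H y (- p)\<bar> \<le> M * (1 + norm p) * norm (x - y)" for x y p
    using lip_x[of x "- p" y] by simp
qed (rule M)

text \<open>The bridge between the two directions of time: after reversal the Barron-Jensen
  inequality becomes the subsolution inequality for the reflected Hamiltonian.\<close>

lemma forward_visc_time_rev_sub:
  assumes "forward_visc H T u" "T > 0"
  shows "visc_sub T (\<lambda>x D. fst D + H x (- snd D)) (time_rev T u)"
  using forward_visc_barron_jensen[OF assms]
  unfolding barron_jensen_def visc_sub_uminus visc_sub_time_rev by fastforce

end

section \<open>Reconstructible initial functions\<close>

theorem theorem1p7:
  fixes H :: "'a::euclidean_space \<Rightarrow> 'a \<Rightarrow> real" and T M :: real and g0 :: "'a \<Rightarrow> real"
  assumes "T > 0"
    and "\<And>x. convex_on UNIV (H x)"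
    and "M \<ge> 0"
    and "\<And>x p q. \<bar>H x p - H x q\<bar> \<le> M * (1 + norm x) * norm (p - q)"
    and "\<And>x y p. \<bar>H x p - H y p\<bar> \<le> M * (1 + norm p) * norm (x - y)"
    and "continuous_on UNIV g0"
  shows "(reconstructible H T g0 \<longleftrightarrow> (\<exists>v. backward_visc H T v \<and> v 0 = g0)) \<and>
         (\<forall>v u w. backward_visc H T v \<and> v 0 = g0 \<and> forward_visc H T u \<and> u 0 = g0 \<and>
             backward_visc H T w \<and> w T = u T \<longrightarrow>
             (\<forall>t\<in>{0..T}. \<forall>x. u t x \<ge> w t x \<and> w t x \<ge> v t x))"
proof -
  note T = \<open>T > 0\<close>
  interpret fw: convex_hamiltonian H M by unfold_locales (use assms in auto)
  interpret bw: convex_hamiltonian "\<lambda>x p. H x (- p)" M by (rule fw.reflected)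
  have main: "u t x \<ge> w t x \<and> w t x \<ge> v t x"
    if v: "backward_visc H T v" "v 0 = g0" and u: "forward_visc H T u" "u 0 = g0"
      and w: "backward_visc H T w" "w T = u T" and t: "t \<in> {0..T}" for v u w t x
  proof -
    have rv: "forward_visc (\<lambda>x p. H x (- p)) T (time_rev T v)"
      and rw: "forward_visc (\<lambda>x p. H x (- p)) T (time_rev T w)"
      using v(1) w(1) by (simp_all add: backward_visc_iff)
    have cu: "continuous_on ({0..T} \<times> UNIV) (\<lambda>(t, x). u t x)" using u(1) by (simp add: forward_visc_iff)
    have wu: "w t x \<le> u t x"
    proof -
      have "time_rev T u (T - t) x \<le> time_rev T w (T - t) x + 0"
      proof (rule bw.comparison[where u = "time_rev T u" and v = "time_rev T w"])
        show "continuous_on ({0..T} \<times> UNIV) (\<lambda>(t, x). time_rev T u t x)"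
          by (rule continuous_on_time_rev[OF cu])
        show "visc_sub T (\<lambda>x D. fst D + H x (- snd D)) (time_rev T u)"
          by (rule fw.forward_visc_time_rev_sub[OF u(1) T])
      qed (use rw T t w(2) in \<open>auto simp: forward_visc_iff time_rev_def\<close>)
      then show ?thesis by (simp add: time_rev_def)
    qed
    have vu: "v s y \<le> u s y" if "s \<in> {0..T}" for s y
    proof -
      have "v s y \<le> u s y + 0"
      proof (rule fw.comparison[where u = v and v = u])
        show "continuous_on ({0..T} \<times> UNIV) (\<lambda>(t, x). v t x)" using v(1) by (simp add: backward_visc_def)
        \<comment> \<open>The bridge is applied to the reversed \<open>v\<close> and the reflected
          Hamiltonian; both operations are involutions, so \<open>v\<close> itself is a forward
          subsolution for \<open>H\<close>.\<close>
        show "visc_sub T (\<lambda>x D. fst D + H x (snd D)) v"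
          using bw.forward_visc_time_rev_sub[OF rv T] by simp
      qed (use u v(2) T that in \<open>auto simp: forward_visc_iff\<close>)
      then show ?thesis by simp
    qed
    \<comment> \<open>In reversed time the values at \<open>T\<close> are initial data, and there
      \<open>v \<le> u = w\<close>.\<close>
    have "time_rev T w (T - t) x \<le> time_rev T v (T - t) x + 0"
      by (rule bw.forward_visc_le[OF rw rv _ T]) (use t T vu[of T] w(2) in \<open>auto simp: time_rev_def\<close>)
    then show ?thesis using wu by (simp add: time_rev_def)
  qed
  have "reconstructible H T g0" if v: "backward_visc H T v" "v 0 = g0" for v
  proof -
    obtain u where u: "forward_visc H T u" "u 0 = g0" using fw.exists_forward_visc[OF assms(6) T] by blast
    have "continuous_on UNIV (\<lambda>x. - u T x)"
      using u(1) T continuous_on_time_slice[of T u T]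
      by (intro continuous_on_minus) (simp add: forward_visc_iff)
    then obtain z where z: "forward_visc (\<lambda>x p. H x (- p)) T z" "z 0 = (\<lambda>x. - u T x)"
      using bw.exists_forward_visc[of "\<lambda>x. - u T x"] T by blast
    define w where "w = time_rev T z"
    have w: "backward_visc H T w" "w T = u T"
      using z by (auto simp: w_def backward_visc_iff time_rev_def fun_eq_iff)
    have "agree_on T u' u" if "forward_visc H T u'" "u' 0 = g0" for u'
      unfolding agree_on_def using fw.forward_visc_unique[OF that(1) u(1)] that(2) u(2) T by simp
    moreover have "agree_on T w' w" if w': "backward_visc H T w'" "w' T = u T" for w'
    proof -
      have "time_rev T w' s x = time_rev T w s x" if "s \<in> {0..T}" for s x
        using bw.forward_visc_unique[of T "time_rev T w'" "time_rev T w" s x] w w' T that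
        by (simp add: backward_visc_iff time_rev_def fun_eq_iff)
      from this[of "T - t" for t] show ?thesis by (simp add: agree_on_def time_rev_def)
    qed
    moreover have "w 0 = g0"
    proof
      fix x
      \<comment> \<open>At time 0 the chain \<open>v \<le> w \<le> u\<close> collapses, because both
        ends equal \<open>g0\<close>.\<close>
      show "w 0 x = g0 x" using main[OF v u w, of 0 x] u(2) v(2) T by simp
    qed
    ultimately show ?thesis unfolding reconstructible_def using u w by blast
  qed
  \<comment> \<open>For the converse, the \<open>w\<close> in the definition of
    \<open>reconstructible\<close> is itself a backward solution starting from
    \<open>g0\<close>.\<close>
  then have "reconstructible H T g0 \<longleftrightarrow> (\<exists>v. backward_visc H T v \<and> v 0 = g0)"
    unfolding reconstructible_def by blast
  then show ?thesis using main by blast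
qed

end
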